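(* There exists an algorithm that takes as input an integer $d\ge 1$ and outputs a finite list of $d$-tuples of nonnegative integers that contains the type of every irreducible $d$-dimensional complex representation of $\mathrm{SL}_2(\mathbf{Z})$.
   Context: For a finite-dimensional complex representation $\rho$ of $\mathrm{SL}_2(\mathbf{Z})$, $M_k(\rho)$ denotes holomorphic vector-valued modular forms of integer weight $k$ for $\rho$ (holomorphic $F:\mathfrak{H}\to\mathbf{C}^d$ with $F(\gamma\tau)=(c\tau+d')^k\rho(\gamma)F(\tau)$ for $\gamma=\begin{pmatrix}a&b\\c&d'\end{pmatrix}$, and $e^{-2\pi i\tau L}F(\tau)$ holomorphic at $q=e^{2\pi i\tau}=0$, where $\rho(T)=e^{2\pi iL}$, $T=\begin{pmatrix}1&1\\0&1\end{pmatrix}$, and the eigenvalues of $L$ have real parts in $[0,1)$). $M(\rho)=\bigoplus_k M_k(\rho)$ is free of rank $d$ over $M=\mathbf{C}[E_4,E_6]$; if $k_1\le\cdots\le k_d$ are the weights of a homogeneous free basis, the type of $\rho$ is $(0,k_2-k_1,\ldots,k_d-k_1)$. *)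

theory Defs
  imports
    "HOL-Analysis.Analysis"
    "HOL-Library.Nat_Bijection"
    "Jordan_Normal_Form.Char_Poly"
    "Jordan_Normal_Form.VS_Connect"
begin

unbundle no vec_syntax
hide_const (open) Finite_Cartesian_Product.vec Finite_Cartesian_Product.mat Determinants.det
no_notation Inner_Product.real_inner_class.inner (infix "\<bullet>" 70)

section \<open>Algorithms\<close>

text \<open>Programs for the partial recursive functions. The recursion argument of \<open>PrimRec\<close> and the
  search variable of \<open>Mu\<close> come first.\<close>

datatype recf =
    Zero
  | Succ
  | Proj nat
  | Comp recf "recf list"
  | PrimRec recf recf
  | Mu recf

inductive computes :: "recf \<Rightarrow> nat list \<Rightarrow> nat \<Rightarrow> bool" where
  "computes Zero xs 0"
| "computes Succ [x] (Suc x)"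
| "i < length xs \<Longrightarrow> computes (Proj i) xs (xs ! i)"
| "list_all2 (\<lambda>g y. computes g xs y) gs ys \<Longrightarrow> computes f ys z \<Longrightarrow> computes (Comp f gs) xs z"
| "computes f xs y \<Longrightarrow> computes (PrimRec f g) (0 # xs) y"
| "computes (PrimRec f g) (n # xs) y \<Longrightarrow> computes g (n # y # xs) z \<Longrightarrow>
     computes (PrimRec f g) (Suc n # xs) z"
| "(\<And>m. m < n \<Longrightarrow> \<exists>y. computes f (m # xs) (Suc y)) \<Longrightarrow> computes f (n # xs) 0 \<Longrightarrow>
     computes (Mu f) xs n"

inductive_cases computes_elims:
  "computes Zero xs z"
  "computes Succ xs z"
  "computes (Proj i) xs z"
  "computes (Comp f gs) xs z"
  "computes (PrimRec f g) (0 # xs) z"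
  "computes (PrimRec f g) (Suc n # xs) z"
  "computes (Mu f) xs z"

lemma computes_deterministic: "computes f xs y \<Longrightarrow> computes f xs z \<Longrightarrow> y = z"
proof (induction arbitrary: z rule: computes.induct)
  case (4 xs gs ys f w)
  from "4.prems" obtain ys' where ys': "list_all2 (\<lambda>g y. computes g xs y) gs ys'" "computes f ys' z"
    by (auto elim: computes_elims)
  have "ys = ys'"
    using "4.IH"(1) ys'(1) by (auto simp: list_all2_conv_all_nth intro!: nth_equalityI)
  with "4.IH"(2) ys'(2) show ?case by blast
next
  case (7 n f xs)
  from "7.prems" have z: "\<And>m. m < z \<Longrightarrow> \<exists>y. computes f (m # xs) (Suc y)" "computes f (z # xs) 0"
    by (auto elim: computes_elims)
  have "\<not> n < z" using z(1)[of n] "7.IH"(2) by blast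
  moreover have "\<not> z < n" using "7.IH"(1)[of z] z(2) by blast
  ultimately show ?case by simp
qed (blast elim: computes_elims)+

definition encode_tuples :: "nat list list \<Rightarrow> nat" where
  "encode_tuples tss = list_encode (map list_encode tss)"

section \<open>Representations of the modular group\<close>

definition SL2Z :: "int mat monoid" where
  "SL2Z = \<lparr>carrier = {A \<in> carrier_mat 2 2. det A = 1}, mult = (*), one = 1\<^sub>m 2\<rparr>"

definition GLC :: "nat \<Rightarrow> complex mat monoid" where
  "GLC d = units_of (ring_mat TYPE(complex) d ())"

definition T_mat :: "int mat" where
  "T_mat = mat_of_rows_list 2 [[1, 1], [0, 1]]"

definition SL2Z_rep :: "nat \<Rightarrow> (int mat \<Rightarrow> complex mat) \<Rightarrow> bool" where
  "SL2Z_rep d \<rho> \<longleftrightarrow> \<rho> \<in> hom SL2Z (GLC d)"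

definition irreducible_rep :: "nat \<Rightarrow> (int mat \<Rightarrow> complex mat) \<Rightarrow> bool" where
  "irreducible_rep d \<rho> \<longleftrightarrow> SL2Z_rep d \<rho> \<and> d \<noteq> 0 \<and>
     (\<forall>W. VectorSpace.subspace class_ring W (module_vec TYPE(complex) d) \<longrightarrow>
       (\<forall>\<gamma> \<in> carrier SL2Z. \<forall>w \<in> W. \<rho> \<gamma> *\<^sub>v w \<in> W) \<longrightarrow>
       W = {0\<^sub>v d} \<or> W = carrier_vec d)"

section \<open>Vector-valued modular forms\<close>

definition upper_half_plane :: "complex set" where
  "upper_half_plane = {\<tau>. Im \<tau> > 0}"

definition moebius_denom :: "int mat \<Rightarrow> complex \<Rightarrow> complex" where
  "moebius_denom \<gamma> \<tau> = of_int (\<gamma> $$ (1, 0)) * \<tau> + of_int (\<gamma> $$ (1, 1))"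

definition moebius_act :: "int mat \<Rightarrow> complex \<Rightarrow> complex" where
  "moebius_act \<gamma> \<tau> =
     (of_int (\<gamma> $$ (0, 0)) * \<tau> + of_int (\<gamma> $$ (0, 1))) / moebius_denom \<gamma> \<tau>"

definition mat_exp :: "complex mat \<Rightarrow> complex mat" where
  "mat_exp A = Matrix.mat (dim_row A) (dim_row A) (\<lambda>(i, j). \<Sum>n. (A ^\<^sub>m n) $$ (i, j) / fact n)"

definition is_exponent_matrix :: "nat \<Rightarrow> (int mat \<Rightarrow> complex mat) \<Rightarrow> complex mat \<Rightarrow> bool" where
  "is_exponent_matrix d \<rho> L \<longleftrightarrow> L \<in> carrier_mat d d \<and>
     \<rho> T_mat = mat_exp ((2 * of_real pi * \<i>) \<cdot>\<^sub>m L) \<and>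
     (\<forall>x. eigenvalue L x \<longrightarrow> 0 \<le> Re x \<and> Re x < 1)"

definition holomorphic_at_cusp :: "nat \<Rightarrow> complex mat \<Rightarrow> (complex \<Rightarrow> complex vec) \<Rightarrow> bool" where
  "holomorphic_at_cusp d L F \<longleftrightarrow> (\<forall>i<d. \<exists>h. h holomorphic_on ball 0 1 \<and>
     (\<forall>\<tau> \<in> upper_half_plane.
       (mat_exp ((- 2 * of_real pi * \<i> * \<tau>) \<cdot>\<^sub>m L) *\<^sub>v F \<tau>) $ i = h (exp (2 * of_real pi * \<i> * \<tau>))))"

text \<open>The exponent matrix exists and is unique, so quantifying it existentially refers to that one
  matrix. Only the values of a form on the upper half plane matter; those elsewhere are
  unconstrained.\<close>

definition modular_forms :: "nat \<Rightarrow> (int mat \<Rightarrow> complex mat) \<Rightarrow> int \<Rightarrow> (complex \<Rightarrow> complex vec) set" where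
  "modular_forms d \<rho> k = {F.
     (\<forall>\<tau> \<in> upper_half_plane. F \<tau> \<in> carrier_vec d) \<and>
     (\<forall>i<d. (\<lambda>\<tau>. F \<tau> $ i) holomorphic_on upper_half_plane) \<and>
     (\<forall>\<gamma> \<in> carrier SL2Z. \<forall>\<tau> \<in> upper_half_plane.
        F (moebius_act \<gamma> \<tau>) = (moebius_denom \<gamma> \<tau> powi k) \<cdot>\<^sub>v (\<rho> \<gamma> *\<^sub>v F \<tau>)) \<and>
     (\<exists>L. is_exponent_matrix d \<rho> L \<and> holomorphic_at_cusp d L F)}"

text \<open>The sum of the spaces of forms of weight \<open>k\<close>, over all integers \<open>k\<close>, inside the space of all
  functions on the upper half plane; this sum is direct.\<close>

definition all_modular_forms :: "nat \<Rightarrow> (int mat \<Rightarrow> complex mat) \<Rightarrow> (complex \<Rightarrow> complex vec) set" where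
  "all_modular_forms d \<rho> = {G. \<exists>K F. finite K \<and> (\<forall>k \<in> K. F k \<in> modular_forms d \<rho> k) \<and>
     (\<forall>\<tau> \<in> upper_half_plane. G \<tau> = Matrix.vec d (\<lambda>i. \<Sum>k\<in>K. F k \<tau> $ i))}"

definition eisenstein :: "nat \<Rightarrow> complex \<Rightarrow> complex" where
  "eisenstein k \<tau> =
     (\<Sum>\<^sub>\<infinity>(m, n) \<in> {(m :: int, n :: int). coprime m n}. 1 / (of_int m * \<tau> + of_int n) ^ k) / 2"

definition modular_ring :: "(complex \<Rightarrow> complex) set" where
  "modular_ring = {f. \<exists>N c. \<forall>\<tau> \<in> upper_half_plane.
     f \<tau> = (\<Sum>i\<le>N. \<Sum>j\<le>N. c i j * eisenstein 4 \<tau> ^ i * eisenstein 6 \<tau> ^ (j :: nat))}"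

definition module_combination ::
    "nat \<Rightarrow> (nat \<Rightarrow> complex \<Rightarrow> complex) \<Rightarrow> (nat \<Rightarrow> complex \<Rightarrow> complex vec) \<Rightarrow> complex \<Rightarrow> complex vec" where
  "module_combination d a F \<tau> = Matrix.vec d (\<lambda>i. \<Sum>j<d. a j \<tau> * F j \<tau> $ i)"

definition homogeneous_free_basis ::
    "nat \<Rightarrow> (int mat \<Rightarrow> complex mat) \<Rightarrow> int list \<Rightarrow> (nat \<Rightarrow> complex \<Rightarrow> complex vec) \<Rightarrow> bool" where
  "homogeneous_free_basis d \<rho> ks F \<longleftrightarrow>
     length ks = d \<and>
     (\<forall>j<d. F j \<in> modular_forms d \<rho> (ks ! j)) \<and>
     (\<forall>G \<in> all_modular_forms d \<rho>. \<exists>a. (\<forall>j<d. a j \<in> modular_ring) \<and>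
        (\<forall>\<tau> \<in> upper_half_plane. G \<tau> = module_combination d a F \<tau>)) \<and>
     (\<forall>a. (\<forall>j<d. a j \<in> modular_ring) \<and>
        (\<forall>\<tau> \<in> upper_half_plane. module_combination d a F \<tau> = 0\<^sub>v d) \<longrightarrow>
        (\<forall>j<d. \<forall>\<tau> \<in> upper_half_plane. a j \<tau> = 0))"

definition is_type :: "nat \<Rightarrow> (int mat \<Rightarrow> complex mat) \<Rightarrow> nat list \<Rightarrow> bool" where
  "is_type d \<rho> ts \<longleftrightarrow> (\<exists>ks F. sorted ks \<and> homogeneous_free_basis d \<rho> ks F \<and>
     ts = map (\<lambda>k. nat (k - ks ! 0)) ks)"

end

theory Submission
  imports Defs "HOL-Complex_Analysis.Conformal_Mappings"
begin

text \<open>Let \<open>F\<^sub>1, \<dots>, F\<^sub>d\<close> be a homogeneous free basis with weights \<open>k\<^sub>1 \<le> \<dots> \<le> k\<^sub>d\<close> for an irreducible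
  representation. If \<open>F\<close> has weight \<open>k\<close>, then \<open>4 E\<^sub>4 F' - k E\<^sub>4' F\<close> is a form of weight \<open>k + 6\<close>. Suppose
  \<open>k\<^bsub>m+1\<^esub> > k\<^sub>m + 6\<close> with \<open>m < d\<close>. Comparing weights, the brackets of \<open>F\<^sub>1, \<dots>, F\<^sub>m\<close> are combinations of
  \<open>F\<^sub>1, \<dots>, F\<^sub>m\<close>, so these solve a first-order linear system wherever \<open>E\<^sub>4 \<noteq> 0\<close>. A nonzero functional
  that kills the \<open>m < d\<close> values at one such point therefore kills \<open>F\<^sub>1, \<dots>, F\<^sub>m\<close> identically, and
  the span of all their values is a proper nonzero invariant subspace, which is impossible. Hence
  all entries of a type are at most \<open>6 (d - 1)\<close>, and the algorithm lists all \<open>d\<close>-tuples of numbers up to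
  \<open>6 d\<close>, read off as base-\<open>(6 d + 1)\<close> digits.\<close>

(* Merging the imports reactivates the notation that Defs switches off. *)
unbundle no vec_syntax
hide_const (open) Finite_Cartesian_Product.vec Finite_Cartesian_Product.mat Determinants.det
no_notation Inner_Product.real_inner_class.inner (infix "\<bullet>" 70)

section \<open>Computable functions\<close>

text \<open>The algorithm never sees a representation: a bound on the entries of a type that is
  computable from \<open>d\<close> suffices, so a crude bound on the gaps is good enough. The 6 is
  the weight gained by the bracket, 4 from \<open>eisenstein 4\<close> and 2 from the derivative.
  Two obstacles shape the argument. The coefficients supplied by a free basis are arbitrary
  polynomials in \<open>eisenstein 4\<close> and \<open>eisenstein 6\<close>, so comparing weights
  first requires homogeneous components. They are extracted pointwise: at a fixed
  \<open>\<tau>\<close> the automorphy factor runs through infinitely many values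
  \<open>\<tau> + n\<close>, and the expansion in the basis becomes an identity of Laurent
  polynomials in that factor. Moreover, the leading coefficient of the differential system vanishes
  at the zeros of \<open>eisenstein 4\<close>. Uniqueness is therefore used only at one point where
  it is nonzero, and the identity theorem carries the conclusion to the whole half plane. The span
  of the values is invariant because of the transformation law, whose scalar factor is never
  0.\<close>

definition computable :: "nat \<Rightarrow> (nat list \<Rightarrow> nat) \<Rightarrow> bool" where
  "computable n \<phi> \<longleftrightarrow> (\<exists>f. \<forall>xs. length xs = n \<longrightarrow> computes f xs (\<phi> xs))"

lemma computable_cong:
  assumes "computable n \<phi>" "\<And>xs. length xs = n \<Longrightarrow> \<phi> xs = \<psi> xs"
  shows "computable n \<psi>"
  using assms unfolding computable_def by metis

lemma computable_proj: "i < n \<Longrightarrow> computable n (\<lambda>xs. xs ! i)"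
  unfolding computable_def by (rule exI[of _ "Proj i"]) (auto intro: computes.intros(3))

lemma computable_comp:
  assumes \<phi>: "computable (length \<psi>s) \<phi>" and \<psi>s: "\<And>\<psi>. \<psi> \<in> set \<psi>s \<Longrightarrow> computable n \<psi>"
  shows "computable n (\<lambda>xs. \<phi> (map (\<lambda>\<psi>. \<psi> xs) \<psi>s))"
proof -
  obtain f where f: "\<And>ys. length ys = length \<psi>s \<Longrightarrow> computes f ys (\<phi> ys)"
    using \<phi> unfolding computable_def by blast
  obtain g where g: "\<And>\<psi> xs. \<psi> \<in> set \<psi>s \<Longrightarrow> length xs = n \<Longrightarrow> computes (g \<psi>) xs (\<psi> xs)"
    using \<psi>s unfolding computable_def by metis
  have "computes (Comp f (map g \<psi>s)) xs (\<phi> (map (\<lambda>\<psi>. \<psi> xs) \<psi>s))" if "length xs = n" for xs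
    by (rule computes.intros(4)[where ys = "map (\<lambda>\<psi>. \<psi> xs) \<psi>s"])
      (auto simp: list_all2_conv_all_nth g that f)
  then show ?thesis unfolding computable_def by blast
qed

lemma computable_Suc:
  assumes "computable n \<phi>" shows "computable n (\<lambda>xs. Suc (\<phi> xs))"
proof -
  have "computable 1 (\<lambda>xs. Suc (xs ! 0))"
    unfolding computable_def
    by (rule exI[of _ Succ]) (auto simp: length_Suc_conv intro: computes.intros(2))
  then show ?thesis
    using computable_comp[of "[\<phi>]" "\<lambda>xs. Suc (xs ! 0)" n] assms by simp
qed

lemma computable_const: "computable n (\<lambda>xs. c)"
proof (induction c)
  case 0
  show ?case unfolding computable_def by (rule exI[of _ Zero]) (auto intro: computes.intros(1))
qed (rule computable_Suc)

lemma computable_rec: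
  assumes a: "computable n a" and \<phi>: "computable n \<phi>" and \<chi>: "computable (Suc (Suc n)) \<chi>"
  shows "computable n (\<lambda>xs. rec_nat (\<phi> xs) (\<lambda>i y. \<chi> (i # y # xs)) (a xs))"
proof -
  obtain f where f: "\<And>xs. length xs = n \<Longrightarrow> computes f xs (\<phi> xs)"
    using \<phi> unfolding computable_def by blast
  obtain g where g: "\<And>xs. length xs = Suc (Suc n) \<Longrightarrow> computes g xs (\<chi> xs)"
    using \<chi> unfolding computable_def by blast
  have fg: "computes (PrimRec f g) (m # xs) (rec_nat (\<phi> xs) (\<lambda>i y. \<chi> (i # y # xs)) m)"
    if "length xs = n" for m xs
    by (induction m) (auto intro!: computes.intros(5) computes.intros(6) f g that)
  \<comment> \<open>\<open>PrimRec\<close> reads its recursion argument off the head of the input.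
    Composing with \<open>a\<close> followed by all projections supplies that head and leaves
    \<open>xs\<close> itself as the tail.\<close>
  define \<psi>s where "\<psi>s = a # map (\<lambda>i xs. xs ! i) [0..<n]"
  have "computable (length \<psi>s)
      (\<lambda>zs. rec_nat (\<phi> (tl zs)) (\<lambda>i y. \<chi> (i # y # tl zs)) (hd zs))"
    unfolding computable_def
    by (rule exI[of _ "PrimRec f g"]) (auto simp: \<psi>s_def length_Suc_conv intro: fg)
  then have "computable n (\<lambda>xs. (\<lambda>zs. rec_nat (\<phi> (tl zs)) (\<lambda>i y. \<chi> (i # y # tl zs)) (hd zs))
      (map (\<lambda>\<psi>. \<psi> xs) \<psi>s))"
    by (rule computable_comp) (auto simp: \<psi>s_def a computable_proj)
  then have "computable n (\<lambda>xs. rec_nat (\<phi> (map (\<lambda>i. xs ! i) [0..<n]))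
      (\<lambda>i y. \<chi> (i # y # map (\<lambda>i. xs ! i) [0..<n])) (a xs))"
    by (simp add: \<psi>s_def comp_def)
  then show ?thesis
    by (rule computable_cong) (metis map_nth)
qed

lemma computable_drop2:
  assumes "computable n \<phi>"
  shows "computable (Suc (Suc n)) (\<lambda>xs. \<phi> (drop 2 xs))"
proof -
  let ?\<psi>s = "map (\<lambda>i xs. xs ! (i + 2)) [0..<n]"
  have "computable (Suc (Suc n)) (\<lambda>xs. \<phi> (map (\<lambda>\<psi>. \<psi> xs) ?\<psi>s))"
    by (rule computable_comp) (use assms in \<open>auto intro: computable_proj\<close>)
  then show ?thesis
    by (rule computable_cong) (auto intro!: arg_cong[of _ _ \<phi>] nth_equalityI simp: add.commute)
qed

text \<open>The recursion step is a curried function of parameters, counter and accumulator, so that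
  recursion equations match the conclusion directly; \<open>drop 2\<close> recovers the parameters
  that stand behind the other two.\<close>

lemma computable_rec':
  assumes a: "computable n a" and \<phi>: "computable n \<phi>"
    and \<chi>: "computable (Suc (Suc n)) (\<lambda>zs. \<chi> (drop 2 zs) (zs ! 0) (zs ! 1))"
  shows "computable n (\<lambda>xs. rec_nat (\<phi> xs) (\<chi> xs) (a xs))"
  using computable_rec[OF a \<phi> \<chi>] by simp

lemma computable_add:
  assumes "computable n \<phi>" "computable n \<psi>"
  shows "computable n (\<lambda>xs. \<phi> xs + \<psi> xs)"
proof -
  have eq: "a + b = rec_nat a (\<lambda>_ y. Suc y) b" for a b :: nat by (induction b) auto
  show ?thesis unfolding eq
    by (intro computable_rec' assms computable_Suc computable_proj) simp
qed

lemma computable_pred: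
  assumes "computable n \<phi>"
  shows "computable n (\<lambda>xs. \<phi> xs - 1)"
proof -
  have eq: "a - 1 = rec_nat 0 (\<lambda>i _. i) a" for a :: nat by (cases a) auto
  show ?thesis unfolding eq
    by (intro computable_rec' assms computable_const computable_proj) simp
qed

lemma computable_diff:
  assumes "computable n \<phi>" "computable n \<psi>"
  shows "computable n (\<lambda>xs. \<phi> xs - \<psi> xs)"
proof -
  have "a - b = rec_nat a (\<lambda>_ y. y - 1) b" for a b :: nat by (induction b) auto
  \<comment> \<open>The right-hand side contains the difference \<open>y - 1\<close>, so unfolding
    the pointwise identity would not terminate. As an equation between these particular functions it
    rewrites once.\<close>
  then have eq: "(\<lambda>xs. \<phi> xs - \<psi> xs) = (\<lambda>xs. rec_nat (\<phi> xs) (\<lambda>_ y. y - 1) (\<psi> xs))" by blast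
  show ?thesis unfolding eq
    by (intro computable_rec' assms computable_pred computable_proj) simp
qed

lemma computable_mult:
  assumes "computable n \<phi>" "computable n \<psi>"
  shows "computable n (\<lambda>xs. \<phi> xs * \<psi> xs)"
proof -
  have eq: "a * b = rec_nat 0 (\<lambda>_ y. y + a) b" for a b :: nat by (induction b) auto
  show ?thesis unfolding eq
    by (intro computable_rec' assms computable_add computable_proj computable_const computable_drop2) simp
qed

lemma computable_power:
  assumes "computable n \<phi>" "computable n \<psi>"
  shows "computable n (\<lambda>xs. \<phi> xs ^ \<psi> xs)"
proof -
  have eq: "a ^ b = rec_nat 1 (\<lambda>_ y. y * a) b" for a b :: nat by (induction b) auto
  show ?thesis unfolding eq
    by (intro computable_rec' assms computable_mult computable_proj computable_const computable_drop2) simp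
qed

lemma computable_prod_encode:
  assumes "computable n \<phi>" "computable n \<psi>"
  shows "computable n (\<lambda>xs. prod_encode (\<phi> xs, \<psi> xs))"
proof -
  have tri: "triangle a = rec_nat 0 (\<lambda>i y. y + Suc i) a" for a by (induction a) auto
  show ?thesis unfolding prod_encode_def prod.case tri
    by (intro computable_rec' assms computable_add computable_Suc computable_proj computable_const) auto
qed

lemma computable_div:
  assumes "computable n \<phi>" "computable n \<psi>"
  shows "computable n (\<lambda>xs. \<phi> xs div \<psi> xs)"
proof -
  \<comment> \<open>The increment is 1 exactly when the next multiple \<open>(y + 1) * b\<close> of \<open>b\<close> is reached.\<close>
  have eq: "a div b = (1 - (1 - b)) * rec_nat 0 (\<lambda>i y. y + (1 - ((y + 1) * b - Suc i))) a" for a b :: nat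
  proof (cases "b = 0")
    case False
    have "a div b = rec_nat 0 (\<lambda>i y. y + (1 - ((y + 1) * b - Suc i))) a"
    proof (induction a)
      case (Suc a)
      have "Suc a div b = a div b + (1 - ((a div b + 1) * b - Suc a))"
      proof (cases "Suc a mod b = 0")
        case True
        then have 1: "Suc a div b = a div b + 1" by (simp add: div_Suc)
        have "Suc a div b * b = Suc a"
          using True by (intro dvd_div_mult_self) (simp only: mod_eq_0_iff_dvd)
        then have "(a div b + 1) * b = Suc a" by (simp only: 1)
        then show ?thesis by (simp only: 1 diff_self_eq_0 diff_zero)
      next
        case F: False
        then have 1: "Suc a div b = a div b" by (simp add: div_Suc)
        have "Suc a < (Suc a div b + 1) * b"
          using False dividend_less_div_times[of b "Suc a"] by simp
        then have "0 < (a div b + 1) * b - Suc a" by (simp only: 1 zero_less_diff)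
        then have "1 - ((a div b + 1) * b - Suc a) = 0" by linarith
        then show ?thesis by (simp only: 1 add_0_right)
      qed
      then show ?case by (simp only: Suc nat.rec)
    qed simp
    \<comment> \<open>The factor \<open>1 - (1 - b)\<close> is 1 here. It is 0 for
      \<open>b = 0\<close>, where it enforces the convention \<open>a div 0 = 0\<close>.\<close>
    then show ?thesis using False by simp
  qed simp
  show ?thesis unfolding eq
    by (intro computable_rec' assms computable_add computable_mult computable_diff computable_Suc
        computable_proj computable_const computable_drop2) auto
qed

lemma computable_mod:
  assumes "computable n \<phi>" "computable n \<psi>"
  shows "computable n (\<lambda>xs. \<phi> xs mod \<psi> xs)"
  unfolding minus_div_mult_eq_mod[symmetric]
  by (intro computable_diff computable_mult computable_div assms)

section \<open>Tuples as digits in a fixed base, most significant digit first\<close>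

fun digits :: "nat \<Rightarrow> nat \<Rightarrow> nat \<Rightarrow> nat list" where
  "digits b 0 e = []"
| "digits b (Suc n) e = (e div b ^ n) mod b # digits b n e"

lemma length_digits [simp]: "length (digits b n e) = n"
  by (induction n) auto

text \<open>A multiple of \<open>b ^ m\<close> changes each quotient \<open>e div b ^ i\<close> with
  \<open>i < m\<close> only by a multiple of \<open>b\<close>. The exponent \<open>m\<close> is kept
  apart from the length \<open>n\<close> because it stays fixed while \<open>n\<close> decreases in
  the induction.\<close>

lemma digits_add_mult: "b > 0 \<Longrightarrow> n \<le> m \<Longrightarrow> digits b n (e + x * b ^ m) = digits b n e"
proof (induction n)
  case (Suc n)
  have "(e + x * b ^ m) div b ^ n = e div b ^ n + b * (x * b ^ (m - Suc n))"
  proof -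
    have "b ^ m = b ^ n * b * b ^ (m - Suc n)"
      using Suc.prems by (metis power_Suc2 power_add le_add_diff_inverse)
    then have "e + x * b ^ m = e + b ^ n * (b * (x * b ^ (m - Suc n)))"
      by (simp only: mult_ac)
    then show ?thesis using Suc.prems by (simp only: div_mult_self2) simp
  qed
  then show ?case using Suc by simp
qed simp

lemma digits_surj: "\<forall>x \<in> set xs. x < b \<Longrightarrow> \<exists>e < b ^ length xs. xs = digits b (length xs) e"
proof (induction xs)
  case (Cons x xs)
  then obtain e where e: "e < b ^ length xs" "xs = digits b (length xs) e" by auto
  have x: "x < b" using Cons.prems by simp
  let ?e = "e + x * b ^ length xs"
  have "?e < Suc x * b ^ length xs" using e by simp
  also have "\<dots> \<le> b * b ^ length xs" using x by (intro mult_right_mono) auto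
  finally have "?e < b ^ length (x # xs)" by simp
  moreover have "digits b (length (x # xs)) ?e = x # xs"
    using e x digits_add_mult[of b "length xs" "length xs" e x] by simp
  ultimately show ?case by metis
qed simp

lemma computable_digits:
  assumes b: "computable k b" and n: "computable k n" and e: "computable k e"
  shows "computable k (\<lambda>xs. list_encode (digits (b xs) (n xs) (e xs)))"
proof -
  have eq: "list_encode (digits b n e) =
      rec_nat 0 (\<lambda>i y. Suc (prod_encode ((e div b ^ i) mod b, y))) n" for b n e
    by (induction n) auto
  show ?thesis unfolding eq
    by (intro computable_rec' assms computable_Suc computable_prod_encode computable_mod computable_div
        computable_power computable_proj computable_const computable_drop2) auto
qed

text \<open>The order is decreasing because primitive recursion on \<open>m\<close> puts the newest
  tuple in front.\<close>

definition digit_table :: "nat \<Rightarrow> nat \<Rightarrow> nat \<Rightarrow> nat list list" where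
  "digit_table b n m = map (digits b n) (rev [0..<m])"

lemma computable_digit_table:
  assumes b: "computable k b" and n: "computable k n" and m: "computable k m"
  shows "computable k (\<lambda>xs. encode_tuples (digit_table (b xs) (n xs) (m xs)))"
proof -
  have eq: "encode_tuples (digit_table b n m) =
      rec_nat 0 (\<lambda>e y. Suc (prod_encode (list_encode (digits b n e), y))) m" for b n m
    by (induction m) (auto simp: encode_tuples_def digit_table_def)
  show ?thesis unfolding eq
    by (intro computable_rec' assms computable_Suc computable_prod_encode computable_digits
        computable_proj computable_const computable_drop2) auto
qed

lemma exists_algorithm_bounded_tuples:
  "\<exists>alg. \<forall>d. \<exists>tss. computes alg [d] (encode_tuples tss) \<and> (\<forall>ts \<in> set tss. length ts = d) \<and>
     (\<forall>ts. length ts = d \<longrightarrow> (\<forall>t \<in> set ts. t \<le> c * d) \<longrightarrow> ts \<in> set tss)"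
proof -
  \<comment> \<open>Numbers up to \<open>c * d\<close> are the digits in base
    \<open>Suc (c * d)\<close>, and the \<open>d\<close>-th power of this base counts the
    tuples.\<close>
  let ?tss = "\<lambda>d. digit_table (Suc (c * d)) d (Suc (c * d) ^ d)"
  have "computable 1 (\<lambda>xs. encode_tuples (?tss (xs ! 0)))"
    by (intro computable_digit_table computable_Suc computable_mult computable_power
        computable_const computable_proj) auto
  then obtain alg where "\<And>xs. length xs = 1 \<Longrightarrow> computes alg xs (encode_tuples (?tss (xs ! 0)))"
    unfolding computable_def by blast
  from this[of "[d]" for d] have "computes alg [d] (encode_tuples (?tss d))" for d by simp
  moreover have "ts \<in> set (?tss d)" if "length ts = d" "\<forall>t \<in> set ts. t \<le> c * d" for ts d
  proof -
    have "\<forall>t \<in> set ts. t < Suc (c * d)" using that by auto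
    from digits_surj[OF this] show ?thesis using that by (auto simp: digit_table_def)
  qed
  moreover have "length ts = d" if "ts \<in> set (?tss d)" for ts d
    using that by (auto simp: digit_table_def)
  ultimately show ?thesis by blast
qed

section \<open>Eisenstein series\<close>

lemma det_2:
  fixes M :: "'a :: comm_ring_1 mat"
  assumes M: "M \<in> carrier_mat 2 2"
  shows "det M = M $$ (0, 0) * M $$ (1, 1) - M $$ (0, 1) * M $$ (1, 0)"
proof -
  have dd: "det (mat_delete M i 0) = M $$ (1 - i, 1)" if "i < 2" for i
  proof -
    have "mat_delete M i 0 \<in> carrier_mat 1 1" using M by (auto simp: mat_delete_def)
    then have "det (mat_delete M i 0) = mat_delete M i 0 $$ (0, 0)" by (rule det_single)
    also have "\<dots> = M $$ (1 - i, 1)" using M that by (auto simp: mat_delete_def less_2_cases_iff)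
    finally show ?thesis .
  qed
  have "det M = (\<Sum>i<2. M $$ (i, 0) * cofactor M i 0)"
    by (rule laplace_expansion_column[OF M]) simp
  also have "\<dots> = M $$ (0, 0) * M $$ (1, 1) - M $$ (0, 1) * M $$ (1, 0)"
    by (simp add: cofactor_def dd numeral_2_eq_2 algebra_simps)
  finally show ?thesis .
qed

lemma SL2Z_det:
  assumes "\<gamma> \<in> carrier SL2Z"
  shows "\<gamma> $$ (0, 0) * \<gamma> $$ (1, 1) - \<gamma> $$ (0, 1) * \<gamma> $$ (1, 0) = 1"
  using assms det_2[of \<gamma>] by (simp add: SL2Z_def)

lemma SL2Z_of_entries:
  assumes "a * d - b * c = 1"
  shows "mat_of_rows_list 2 [[a, b], [c, d]] \<in> carrier SL2Z"
proof -
  have "mat_of_rows_list 2 [[a, b], [c, d]] \<in> carrier_mat 2 2"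
    by (simp add: mat_of_rows_list_def numeral_2_eq_2)
  moreover from det_2[OF this] have "det (mat_of_rows_list 2 [[a, b], [c, d]]) = 1"
    using assms by (simp add: mat_of_rows_list_def)
  ultimately show ?thesis by (simp add: SL2Z_def)
qed

lemma lattice_point_nonzero:
  fixes m n :: int
  assumes "Im \<tau> > 0" "(m, n) \<noteq> (0, 0)"
  shows "of_int m * \<tau> + of_int n \<noteq> 0"
proof
  assume eq: "of_int m * \<tau> + of_int n = 0"
  then have "Im (of_int m * \<tau> + of_int n) = 0" by simp
  then have "m = 0" using assms(1) by simp
  with eq show False using assms(2) by simp
qed

lemma moebius_denom_nonzero:
  assumes "\<gamma> \<in> carrier SL2Z" "\<tau> \<in> upper_half_plane"
  shows "moebius_denom \<gamma> \<tau> \<noteq> 0"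
  unfolding moebius_denom_def
  by (rule lattice_point_nonzero) (use assms SL2Z_det[OF assms(1)] in \<open>auto simp: upper_half_plane_def\<close>)

lemma moebius_act_in_upper_half_plane:
  assumes g: "\<gamma> \<in> carrier SL2Z" and t: "\<tau> \<in> upper_half_plane"
  shows "moebius_act \<gamma> \<tau> \<in> upper_half_plane"
proof -
  define a b c d where abcd: "a = real_of_int (\<gamma> $$ (0, 0))" "b = real_of_int (\<gamma> $$ (0, 1))"
    "c = real_of_int (\<gamma> $$ (1, 0))" "d = real_of_int (\<gamma> $$ (1, 1))"
  have det: "a * d - b * c = 1"
    using SL2Z_det[OF g] unfolding abcd by (metis of_int_1 of_int_diff of_int_mult)
  define w where "w = moebius_denom \<gamma> \<tau>"
  have w: "w \<noteq> 0" unfolding w_def by (rule moebius_denom_nonzero[OF g t])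
  have w': "Re w = c * Re \<tau> + d" "Im w = c * Im \<tau>"
    by (simp_all add: w_def moebius_denom_def abcd)
  have "Im (moebius_act \<gamma> \<tau>) =
      (a * Im \<tau> * Re w - (a * Re \<tau> + b) * Im w) / ((Re w)\<^sup>2 + (Im w)\<^sup>2)"
    by (simp add: moebius_act_def w_def[symmetric] Im_divide abcd)
  also have "a * Im \<tau> * Re w - (a * Re \<tau> + b) * Im w = (a * d - b * c) * Im \<tau>"
    unfolding w' by (simp add: algebra_simps)
  also have "\<dots> / ((Re w)\<^sup>2 + (Im w)\<^sup>2) > 0"
    using w t unfolding det by (auto simp: upper_half_plane_def complex_eq_iff sum_power2_gt_zero_iff)
  finally show ?thesis by (simp add: upper_half_plane_def)
qed

section \<open>Convergence, holomorphy and modularity of the Eisenstein series\<close>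

definition coprime_pairs :: "(int \<times> int) set" where
  "coprime_pairs = {(m, n). coprime m n}"

text \<open>A product of one-variable terms, so that summability over pairs reduces to summability
  over \<open>int\<close>. It is independent of \<open>\<tau>\<close> and so, up to a constant,
  serves whole regions at once; the 3 comes from \<open>inverse_square_form_le\<close>.\<close>

definition lattice_majorant :: "int \<times> int \<Rightarrow> real" where
  "lattice_majorant = (\<lambda>(m, n). 3 / ((1 + (of_int m)\<^sup>2) * (1 + (of_int n)\<^sup>2)))"

lemma summable_on_inverse_Suc_square_int: "(\<lambda>n::int. 1 / (1 + (of_int n)\<^sup>2) :: real) summable_on UNIV"
proof -
  let ?f = "\<lambda>n::int. 1 / (1 + (of_int n)\<^sup>2) :: real"
  have s: "summable (\<lambda>n::nat. 1 / (1 + (of_nat n)\<^sup>2) :: real)"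
  proof (rule summable_comparison_test')
    show "summable (\<lambda>n::nat. 1 / (of_nat n)\<^sup>2 :: real)"
      using inverse_power_summable[of 2, where 'a = real] by (simp add: inverse_eq_divide)
    show "norm (1 / (1 + (of_nat n)\<^sup>2) :: real) \<le> 1 / (of_nat n)\<^sup>2" if "n \<ge> 1" for n :: nat
    proof -
      have "(of_nat n)\<^sup>2 > (0 :: real)" using that by simp
      then show ?thesis by (auto intro!: divide_left_mono mult_pos_pos add_pos_pos)
    qed
  qed
  then have nat: "(\<lambda>n::nat. 1 / (1 + (of_nat n)\<^sup>2) :: real) summable_on UNIV"
    by (intro norm_summable_imp_summable_on) simp
  have "?f summable_on (int ` UNIV)"
    by (subst summable_on_reindex) (use nat in \<open>auto simp: o_def\<close>)
  moreover have "?f summable_on ((\<lambda>n. - int n) ` UNIV)"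
    by (subst summable_on_reindex) (use nat in \<open>auto simp: o_def inj_on_def\<close>)
  ultimately have "?f summable_on (int ` UNIV \<union> (\<lambda>n. - int n) ` UNIV)"
    by (rule summable_on_union)
  moreover have "int ` UNIV \<union> (\<lambda>n. - int n) ` UNIV = UNIV"
    by (auto simp: image_iff) (metis int_cases2)
  ultimately show ?thesis by simp
qed

lemma summable_on_lattice_majorant: "lattice_majorant summable_on A"
proof -
  let ?f = "\<lambda>n::int. 1 / (1 + (of_int n)\<^sup>2) :: real"
  have "lattice_majorant summable_on (UNIV \<times> UNIV)"
  proof (rule summable_on_SigmaI)
    fix m :: int
    show "((\<lambda>n. lattice_majorant (m, n)) has_sum (3 * ?f m * infsum ?f UNIV)) UNIV"
      using has_sum_cmult_right[OF has_sum_infsum[OF summable_on_inverse_Suc_square_int], of "3 * ?f m"]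
      by (simp add: lattice_majorant_def)
  next
    show "(\<lambda>m. 3 * ?f m * infsum ?f UNIV) summable_on UNIV"
      by (intro summable_on_cmult_left summable_on_cmult_right summable_on_inverse_Suc_square_int)
  qed (auto simp: lattice_majorant_def)
  then show ?thesis by (rule summable_on_subset) auto
qed

lemma lattice_majorant_nonneg: "lattice_majorant p \<ge> 0"
  by (auto simp: lattice_majorant_def split: prod.split)

text \<open>Put \<open>S = u^2 + v^2\<close>. The product \<open>(1 + u^2) * (1 + v^2)\<close>
  expands to \<open>1 + S + u^2 * v^2\<close>, and since \<open>S \<ge> 1\<close> each of the three
  summands is at most \<open>S^2\<close>.\<close>

lemma inverse_square_form_le:
  fixes u v :: real
  assumes "u\<^sup>2 + v\<^sup>2 \<ge> 1"
  shows "1 / (u\<^sup>2 + v\<^sup>2)\<^sup>2 \<le> 3 / ((1 + u\<^sup>2) * (1 + v\<^sup>2))"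
proof -
  let ?S = "u\<^sup>2 + v\<^sup>2"
  have "1 \<le> ?S\<^sup>2" using assms by (simp add: one_le_power)
  moreover have "?S \<le> ?S\<^sup>2" using assms by (simp add: power2_eq_square)
  moreover have "u\<^sup>2 * v\<^sup>2 \<le> ?S * ?S" by (intro mult_mono) auto
  ultimately have "(1 + u\<^sup>2) * (1 + v\<^sup>2) \<le> 3 * ?S\<^sup>2"
    by (simp add: algebra_simps power2_eq_square)
  moreover have "(1 + u\<^sup>2) * (1 + v\<^sup>2) > 0" by (intro mult_pos_pos) (auto simp: add_pos_nonneg)
  moreover have "?S > 0" using assms by linarith
  ultimately show ?thesis by (simp add: divide_simps)
qed

lemma coprime_pair_square_sum_ge_1:
  assumes "(m, n) \<in> coprime_pairs"
  shows "(real_of_int m)\<^sup>2 + (real_of_int n)\<^sup>2 \<ge> 1"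
proof -
  have "m \<noteq> 0 \<or> n \<noteq> 0" using assms by (auto simp: coprime_pairs_def)
  then have "m\<^sup>2 + n\<^sup>2 > 0" by (simp add: sum_power2_gt_zero_iff)
  then have "m\<^sup>2 + n\<^sup>2 \<ge> 1" by linarith
  then have "real_of_int (m\<^sup>2 + n\<^sup>2) \<ge> real_of_int 1" by (rule iffD2[OF of_int_le_iff])
  then show ?thesis by simp
qed

text \<open>The squared norm of \<open>m * \<tau> + n\<close> dominates a positive multiple of
  \<open>m^2 + n^2\<close>, uniformly while \<open>\<tau>\<close> stays in a vertical strip and away
  from the real axis. Thanks to this uniformity one estimate yields convergence, holomorphy and
  boundedness at the cusp.\<close>

lemma eisenstein_term_bound:
  assumes \<delta>: "\<delta> > 0" and k: "k \<ge> 4"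
  obtains K where "\<And>\<tau> m n. \<bar>Re \<tau>\<bar> \<le> R \<Longrightarrow> Im \<tau> \<ge> \<delta> \<Longrightarrow> (m, n) \<in> coprime_pairs \<Longrightarrow>
       norm (1 / (of_int m * \<tau> + of_int n) ^ k) \<le> K * lattice_majorant (m, n)"
proof
  define C where "C = 1 / \<delta>\<^sup>2 + 2 * R\<^sup>2 / \<delta>\<^sup>2 + 2"
  have C: "C > 0" by (auto simp: C_def intro!: add_nonneg_pos)
  fix \<tau> :: complex and m n :: int
  assume R: "\<bar>Re \<tau>\<bar> \<le> R" and I: "Im \<tau> \<ge> \<delta>" and mn: "(m, n) \<in> coprime_pairs"
  define x y u v where xy: "x = Re \<tau>" "y = Im \<tau>" "u = real_of_int m" "v = real_of_int n"
  define z where "z = of_int m * \<tau> + of_int n"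
  have z2: "(norm z)\<^sup>2 = (u * x + v)\<^sup>2 + (u * y)\<^sup>2"
    by (simp add: z_def xy cmod_power2)
  have y2: "\<delta>\<^sup>2 \<le> y\<^sup>2" using I \<delta> by (simp add: xy power_mono)
  have x2: "x\<^sup>2 \<le> R\<^sup>2" using R by (simp add: xy abs_le_square_iff[symmetric])
  have u2: "u\<^sup>2 \<le> (u * y)\<^sup>2 / \<delta>\<^sup>2"
  proof -
    have "u\<^sup>2 * \<delta>\<^sup>2 \<le> u\<^sup>2 * y\<^sup>2" using y2 by (intro mult_left_mono) auto
    then show ?thesis using \<delta> by (simp add: field_simps power_mult_distrib)
  qed
  \<comment> \<open>Here \<open>v\<close> is \<open>u * x + v\<close> minus \<open>u * x\<close>,
    and a squared difference is at most twice the sum of the squares.\<close>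
  have "v\<^sup>2 \<le> 2 * (u * x + v)\<^sup>2 + 2 * (u * x)\<^sup>2"
    using zero_le_power2[of "u * x + v + u * x"] by (simp add: power2_eq_square algebra_simps)
  also have "(u * x)\<^sup>2 \<le> R\<^sup>2 * u\<^sup>2"
    using mult_left_mono[OF x2, of "u\<^sup>2"] by (simp add: power_mult_distrib mult.commute)
  also have "R\<^sup>2 * u\<^sup>2 \<le> R\<^sup>2 * ((u * y)\<^sup>2 / \<delta>\<^sup>2)" using u2 by (intro mult_left_mono) auto
  finally have v2: "v\<^sup>2 \<le> 2 * (u * x + v)\<^sup>2 + 2 * (R\<^sup>2 * ((u * y)\<^sup>2 / \<delta>\<^sup>2))" by simp
  have "u\<^sup>2 + v\<^sup>2 \<le> (1 / \<delta>\<^sup>2 + 2 * R\<^sup>2 / \<delta>\<^sup>2) * (u * y)\<^sup>2 + 2 * (u * x + v)\<^sup>2"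
    using u2 v2 by (simp add: algebra_simps)
  also have "\<dots> \<le> C * (u * y)\<^sup>2 + C * (u * x + v)\<^sup>2"
  proof -
    have "1 / \<delta>\<^sup>2 + 2 * R\<^sup>2 / \<delta>\<^sup>2 \<le> C" "2 \<le> C" unfolding C_def by simp_all
    then show ?thesis by (meson add_mono mult_right_mono zero_le_power2)
  qed
  also have "\<dots> = (sqrt C * norm z)\<^sup>2" using C by (simp add: power_mult_distrib z2 algebra_simps)
  finally have S: "u\<^sup>2 + v\<^sup>2 \<le> (sqrt C * norm z)\<^sup>2" .
  have S1: "u\<^sup>2 + v\<^sup>2 \<ge> 1" using coprime_pair_square_sum_ge_1[OF mn] by (simp add: xy)
  have "1\<^sup>2 \<le> (sqrt C * norm z)\<^sup>2" using S S1 by simp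
  \<comment> \<open>Since this quantity is at least 1, the exponent \<open>k\<close> can be lowered
    to 4, the case that the majorant covers.\<close>
  then have "1 \<le> sqrt C * norm z" by (rule power2_le_imp_le) (use C in auto)
  then have "(sqrt C * norm z) ^ 4 \<le> (sqrt C * norm z) ^ k" by (intro power_increasing k)
  moreover have "(u\<^sup>2 + v\<^sup>2)\<^sup>2 \<le> ((sqrt C * norm z)\<^sup>2)\<^sup>2"
    using S S1 by (intro power_mono) auto
  ultimately have le: "(u\<^sup>2 + v\<^sup>2)\<^sup>2 \<le> sqrt C ^ k * norm z ^ k"
    by (simp add: power_mult_distrib flip: power_mult)
  have "norm z \<noteq> 0" using \<open>1 \<le> sqrt C * norm z\<close> by auto
  then have "1 / norm z ^ k \<le> sqrt C ^ k * (1 / (u\<^sup>2 + v\<^sup>2)\<^sup>2)"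
    using le S1 by (auto simp: divide_simps mult.commute)
  also have "\<dots> \<le> sqrt C ^ k * lattice_majorant (m, n)"
    using inverse_square_form_le[OF S1] C
    by (intro mult_left_mono) (auto simp: lattice_majorant_def xy)
  finally show "norm (1 / (of_int m * \<tau> + of_int n) ^ k) \<le> sqrt C ^ k * lattice_majorant (m, n)"
    by (simp add: z_def norm_divide norm_power)
qed

lemma eisenstein_alt_def:
  "eisenstein k \<tau> = (\<Sum>\<^sub>\<infinity>p\<in>coprime_pairs. 1 / (of_int (fst p) * \<tau> + of_int (snd p)) ^ k) / 2"
  unfolding eisenstein_def coprime_pairs_def by (simp add: case_prod_unfold)

lemma eisenstein_abs_summable:
  assumes "k \<ge> 4" "Im \<tau> > 0"
  shows "(\<lambda>p. norm (1 / (of_int (fst p) * \<tau> + of_int (snd p)) ^ k)) summable_on coprime_pairs"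
proof -
  obtain K where "\<And>\<tau>' m n. \<bar>Re \<tau>'\<bar> \<le> \<bar>Re \<tau>\<bar> \<Longrightarrow> Im \<tau>' \<ge> Im \<tau> \<Longrightarrow> (m, n) \<in> coprime_pairs \<Longrightarrow>
       norm (1 / (of_int m * \<tau>' + of_int n) ^ k) \<le> K * lattice_majorant (m, n)"
    using eisenstein_term_bound[OF assms(2,1), of "\<bar>Re \<tau>\<bar>"] by metis
  then show ?thesis
    by (intro Infinite_Sum.abs_summable_on_comparison_test'[where g = "\<lambda>p. K * lattice_majorant p"]
        summable_on_cmult_right summable_on_lattice_majorant) auto
qed

lemma open_upper_half_plane: "open upper_half_plane"
  unfolding upper_half_plane_def by (rule open_halfspace_Im_gt)

lemma connected_upper_half_plane: "connected upper_half_plane"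
  unfolding upper_half_plane_def by (intro convex_connected convex_halfspace_Im_gt)

lemma eisenstein_holomorphic:
  assumes k: "k \<ge> 4"
  shows "eisenstein k holomorphic_on upper_half_plane"
proof -
  have "eisenstein k field_differentiable at z" if z: "z \<in> upper_half_plane" for z
  proof -
    \<comment> \<open>With half the height as radius, the closed disc stays at height at least
      \<open>r\<close>, where the term bound is uniform.\<close>
    define r where "r = Im z / 2"
    have r: "r > 0" using z by (simp add: r_def upper_half_plane_def)
    have cb: "\<bar>Re \<tau>\<bar> \<le> \<bar>Re z\<bar> + r" "Im \<tau> \<ge> r" if "\<tau> \<in> cball z r" for \<tau>
    proof -
      have "\<bar>Re (\<tau> - z)\<bar> \<le> r" "\<bar>Im (\<tau> - z)\<bar> \<le> r"
        using that abs_Re_le_cmod[of "\<tau> - z"] abs_Im_le_cmod[of "\<tau> - z"]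
        by (auto simp: dist_norm norm_minus_commute)
      then show "\<bar>Re \<tau>\<bar> \<le> \<bar>Re z\<bar> + r" "Im \<tau> \<ge> r" unfolding r_def by (simp_all only: minus_complex.sel)
    qed
    obtain K where K: "\<And>\<tau> m n. \<bar>Re \<tau>\<bar> \<le> \<bar>Re z\<bar> + r \<Longrightarrow> Im \<tau> \<ge> r \<Longrightarrow> (m, n) \<in> coprime_pairs \<Longrightarrow>
       norm (1 / (of_int m * \<tau> + of_int n) ^ k) \<le> K * lattice_majorant (m, n)"
      using eisenstein_term_bound[OF r k] by metis
    let ?g = "\<lambda>\<tau>. \<Sum>\<^sub>\<infinity>p\<in>coprime_pairs. 1 / (of_int (fst p) * \<tau> + of_int (snd p)) ^ k"
    have ul: "uniform_limit (cball z r)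
        (\<lambda>X \<tau>. \<Sum>p\<in>X. 1 / (of_int (fst p) * \<tau> + of_int (snd p)) ^ k) ?g
        (finite_subsets_at_top coprime_pairs)"
      by (rule Weierstrass_m_test_general[where M = "\<lambda>p. K * lattice_majorant p"])
        (use K cb in \<open>auto intro!: summable_on_cmult_right summable_on_lattice_majorant\<close>)
    have hol: "(\<lambda>\<tau>. \<Sum>p\<in>X. 1 / (of_int (fst p) * \<tau> + of_int (snd p)) ^ k) holomorphic_on cball z r"
      if "X \<subseteq> coprime_pairs" for X
    proof (intro holomorphic_intros)
      fix p \<tau> assume "p \<in> X" "\<tau> \<in> cball z r"
      then show "(of_int (fst p) * \<tau> + of_int (snd p)) ^ k \<noteq> 0"
        using that cb(2) r lattice_point_nonzero[of \<tau> "fst p" "snd p"]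
        by (force simp: coprime_pairs_def)
    qed
    have ev: "\<forall>\<^sub>F X in finite_subsets_at_top coprime_pairs.
        continuous_on (cball z r) (\<lambda>\<tau>. \<Sum>p\<in>X. 1 / (of_int (fst p) * \<tau> + of_int (snd p)) ^ k) \<and>
        (\<lambda>\<tau>. \<Sum>p\<in>X. 1 / (of_int (fst p) * \<tau> + of_int (snd p)) ^ k) holomorphic_on ball z r"
      by (rule eventually_finite_subsets_at_top_weakI, intro conjI)
        (use hol in \<open>blast intro: holomorphic_on_imp_continuous_on
           holomorphic_on_subset[OF _ ball_subset_cball]\<close>)+
    have "?g holomorphic_on ball z r"
      by (rule holomorphic_uniform_limit[OF ev ul]) auto
    then have "eisenstein k holomorphic_on ball z r"
      unfolding eisenstein_alt_def[abs_def] by (intro holomorphic_intros) auto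
    then show ?thesis using r by (simp add: holomorphic_on_imp_differentiable_at)
  qed
  then show ?thesis by (simp add: holomorphic_on_def field_differentiable_at_within)
qed

text \<open>Right multiplication by \<open>\<gamma>\<close> permutes the coprime rows and turns the
  denominators at \<open>moebius_act \<gamma> \<tau>\<close> into those at \<open>\<tau>\<close>, up
  to the automorphy factor. Reindexing and extracting a constant respect the default value of
  \<open>infsum\<close>, so every exponent \<open>k\<close> is covered.\<close>

lemma eisenstein_moebius:
  assumes g: "\<gamma> \<in> carrier SL2Z" and t: "\<tau> \<in> upper_half_plane"
  shows "eisenstein k (moebius_act \<gamma> \<tau>) = moebius_denom \<gamma> \<tau> ^ k * eisenstein k \<tau>"
proof -
  define a b c d where abcd: "a = \<gamma> $$ (0, 0)" "b = \<gamma> $$ (0, 1)" "c = \<gamma> $$ (1, 0)" "d = \<gamma> $$ (1, 1)"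
  have det: "a * d - b * c = 1" using SL2Z_det[OF g] by (simp add: abcd)
  define w where "w = moebius_denom \<gamma> \<tau>"
  have w: "w \<noteq> 0" unfolding w_def by (rule moebius_denom_nonzero[OF g t])
  have w': "w = of_int c * \<tau> + of_int d" by (simp add: w_def moebius_denom_def abcd)
  \<comment> \<open>Row vectors times \<open>\<gamma>\<close>; the map \<open>h'\<close> multiplies
    by the inverse matrix.\<close>
  define h where "h = (\<lambda>p::int \<times> int. (fst p * a + snd p * c, fst p * b + snd p * d))"
  define h' where "h' = (\<lambda>p::int \<times> int. (fst p * d - snd p * c, snd p * a - fst p * b))"
  \<comment> \<open>A common divisor of the new entries divides the old ones times the determinant.
    The entries are general so that the claim serves both \<open>\<gamma>\<close> and its
    inverse.\<close>
  have cop: "coprime (fst p * a' + snd p * c') (fst p * b' + snd p * d')"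
    if "coprime (fst p) (snd p)" "a' * d' - b' * c' = 1" for p :: "int \<times> int" and a' b' c' d' :: int
  proof (rule coprimeI)
    fix e assume e: "e dvd fst p * a' + snd p * c'" "e dvd fst p * b' + snd p * d'"
    have "e dvd (fst p * a' + snd p * c') * d' - (fst p * b' + snd p * d') * c'"
      using e by (intro dvd_diff dvd_mult2)
    also have "\<dots> = fst p * (a' * d' - b' * c')" by (simp add: algebra_simps)
    finally have "e dvd fst p" using that by simp
    moreover have "e dvd (fst p * b' + snd p * d') * a' - (fst p * a' + snd p * c') * b'"
      using e by (intro dvd_diff dvd_mult2)
    then have "e dvd snd p * (a' * d' - b' * c')" by (simp add: algebra_simps)
    then have "e dvd snd p" using that by simp
    ultimately show "is_unit e" using that(1) by (meson coprime_common_divisor)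
  qed
  have bij: "bij_betw h coprime_pairs coprime_pairs"
  proof (rule bij_betwI[where g = h'])
    show "h \<in> coprime_pairs \<rightarrow> coprime_pairs"
      using cop[OF _ det] by (auto simp: h_def coprime_pairs_def)
    show "h' \<in> coprime_pairs \<rightarrow> coprime_pairs"
      using cop[of _ d a "- b" "- c"] det by (auto simp: h'_def coprime_pairs_def algebra_simps)
    fix p
    have "fst (h' (h p)) = fst p * (a * d - b * c)" "snd (h' (h p)) = snd p * (a * d - b * c)"
      "fst (h (h' p)) = fst p * (a * d - b * c)" "snd (h (h' p)) = snd p * (a * d - b * c)"
      by (simp_all add: h_def h'_def algebra_simps)
    then show "h' (h p) = p" "h (h' p) = p" by (simp_all add: det prod_eq_iff)
  qed
  have term_eq: "1 / (of_int (fst p) * moebius_act \<gamma> \<tau> + of_int (snd p)) ^ k =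
      w ^ k * (1 / (of_int (fst (h p)) * \<tau> + of_int (snd (h p))) ^ k)" for p
  proof -
    have "of_int (fst p) * moebius_act \<gamma> \<tau> + of_int (snd p) =
        (of_int (fst (h p)) * \<tau> + of_int (snd (h p))) / w"
      using w by (simp add: moebius_act_def w_def[symmetric] abcd[unfolded One_nat_def, symmetric] h_def
          divide_simps) (simp add: w' algebra_simps)
    then show ?thesis by (simp add: power_divide)
  qed
  have "eisenstein k (moebius_act \<gamma> \<tau>) =
      w ^ k * (\<Sum>\<^sub>\<infinity>p\<in>coprime_pairs. 1 / (of_int (fst (h p)) * \<tau> + of_int (snd (h p))) ^ k) / 2"
    unfolding eisenstein_alt_def term_eq infsum_cmult_right' ..
  also have "(\<Sum>\<^sub>\<infinity>p\<in>coprime_pairs. 1 / (of_int (fst (h p)) * \<tau> + of_int (snd (h p))) ^ k) =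
      (\<Sum>\<^sub>\<infinity>p\<in>coprime_pairs. 1 / (of_int (fst p) * \<tau> + of_int (snd p)) ^ k)"
    by (rule infsum_reindex_bij_betw[OF bij])
  finally show ?thesis by (simp add: eisenstein_alt_def w_def)
qed

section \<open>The Eisenstein series near the cusp\<close>

lemma eisenstein_plus_of_int:
  assumes "\<tau> \<in> upper_half_plane"
  shows "eisenstein k (\<tau> + of_int n) = eisenstein k \<tau>"
  using eisenstein_moebius[OF SL2Z_of_entries[of 1 1 n 0] assms, of k]
  by (simp add: moebius_act_def moebius_denom_def mat_of_rows_list_def)

text \<open>The term bound is uniform only over a vertical strip; translation by the integer part of
  \<open>Re \<tau>\<close> brings every point into it.\<close>

lemma eisenstein_bounded_at_cusp:
  assumes k: "k \<ge> 4"
  obtains B where "\<And>\<tau>. Im \<tau> \<ge> 1 \<Longrightarrow> norm (eisenstein k \<tau>) \<le> B"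
proof -
  have "(0 :: real) < 1" by simp
  obtain K where K: "\<And>\<tau> m n. \<bar>Re \<tau>\<bar> \<le> 1 \<Longrightarrow> Im \<tau> \<ge> 1 \<Longrightarrow> (m, n) \<in> coprime_pairs \<Longrightarrow>
       norm (1 / (of_int m * \<tau> + of_int n) ^ k) \<le> K * lattice_majorant (m, n)"
    using eisenstein_term_bound[OF \<open>(0 :: real) < 1\<close> k, of 1] by metis
  define B where "B = infsum (\<lambda>p. K * lattice_majorant p) coprime_pairs / 2"
  have B: "norm (eisenstein k \<tau>) \<le> B" if "\<bar>Re \<tau>\<bar> \<le> 1" "Im \<tau> \<ge> 1" for \<tau>
  proof -
    have "norm (\<Sum>\<^sub>\<infinity>p\<in>coprime_pairs. 1 / (of_int (fst p) * \<tau> + of_int (snd p)) ^ k)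
        \<le> infsum (\<lambda>p. K * lattice_majorant p) coprime_pairs"
    proof (rule norm_infsum_le)
      show "((\<lambda>p. 1 / (of_int (fst p) * \<tau> + of_int (snd p)) ^ k) has_sum
          (\<Sum>\<^sub>\<infinity>p\<in>coprime_pairs. 1 / (of_int (fst p) * \<tau> + of_int (snd p)) ^ k)) coprime_pairs"
        by (rule has_sum_infsum, rule Infinite_Sum.abs_summable_summable,
            rule eisenstein_abs_summable[OF k]) (use that in auto)
      show "((\<lambda>p. K * lattice_majorant p) has_sum
          infsum (\<lambda>p. K * lattice_majorant p) coprime_pairs) coprime_pairs"
        by (intro has_sum_infsum summable_on_cmult_right summable_on_lattice_majorant)
    qed (use K that in auto)
    then show ?thesis by (simp add: eisenstein_alt_def B_def norm_divide)
  qed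
  have "norm (eisenstein k \<tau>) \<le> B" if "Im \<tau> \<ge> 1" for \<tau>
  proof -
    have "eisenstein k (\<tau> + of_int (- \<lfloor>Re \<tau>\<rfloor>)) = eisenstein k \<tau>"
      using that by (intro eisenstein_plus_of_int) (auto simp: upper_half_plane_def)
    moreover have "norm (eisenstein k (\<tau> + of_int (- \<lfloor>Re \<tau>\<rfloor>))) \<le> B"
    proof (rule B)
      show "\<bar>Re (\<tau> + of_int (- \<lfloor>Re \<tau>\<rfloor>))\<bar> \<le> 1" by (simp add: abs_le_iff) linarith
    qed (use that in simp)
    ultimately show ?thesis by simp
  qed
  then show ?thesis by (rule that)
qed

text \<open>High on the imaginary axis the pairs \<open>(0, 1)\<close> and \<open>(0, -1)\<close>
  contribute exactly 2 to the sum, while the others add up to at most \<open>2 * M / y^2\<close>.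
  The choice \<open>y = M + 1\<close> makes this less than 2.\<close>

lemma eisenstein_4_nonzero:
  obtains \<tau> where "\<tau> \<in> upper_half_plane" "eisenstein 4 \<tau> \<noteq> 0"
proof -
  define M where "M = infsum lattice_majorant {p \<in> coprime_pairs. fst p \<noteq> 0}"
  have M: "M \<ge> 0" unfolding M_def by (intro infsum_nonneg lattice_majorant_nonneg)
  define y where "y = M + 1"
  have y: "y \<ge> 1" using M by (simp add: y_def)
  define \<tau> where "\<tau> = \<i> * of_real y"
  let ?f = "\<lambda>p. 1 / (of_int (fst p) * \<tau> + of_int (snd p)) ^ 4"
  let ?A = "{p \<in> coprime_pairs. fst p \<noteq> 0}"
  have t: "Im \<tau> > 0" using y by (simp add: \<tau>_def)
  have "?f summable_on coprime_pairs"
    by (rule Infinite_Sum.abs_summable_summable, rule eisenstein_abs_summable) (use t in auto)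
  then have sA: "?f summable_on ?A" by (rule summable_on_subset) auto
  have split: "coprime_pairs = ?A \<union> {(0, 1), (0, -1)}"
    by (auto simp: coprime_pairs_def abs_if split: if_splits)
  have "infsum ?f coprime_pairs = infsum ?f ?A + infsum ?f {(0, 1), (0, -1)}"
    by (subst split, rule infsum_Un_disjoint) (use sA in auto)
  then have eq: "infsum ?f coprime_pairs = infsum ?f ?A + 2" by simp
  have "norm (infsum ?f ?A) \<le> 2 / y\<^sup>2 * M"
  proof (rule norm_infsum_le[OF has_sum_infsum[OF sA]])
    show "((\<lambda>p. 2 / y\<^sup>2 * lattice_majorant p) has_sum 2 / y\<^sup>2 * M) ?A"
      unfolding M_def by (intro has_sum_cmult_right has_sum_infsum summable_on_lattice_majorant)
    fix p :: "int \<times> int" assume p: "p \<in> ?A"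
    define u v where uv: "u = real_of_int (fst p)" "v = real_of_int (snd p)"
    have "\<bar>fst p\<bar> \<ge> 1" using p by auto
    then have "1 \<le> \<bar>u\<bar>" unfolding uv by linarith
    then have u: "u\<^sup>2 \<ge> 1" using abs_le_square_iff[of 1 u] by simp
    have "u\<^sup>2 * y\<^sup>2 \<ge> 1 * 1" using u y by (intro mult_mono) auto
    then have 1: "(u * y)\<^sup>2 + v\<^sup>2 \<ge> 1" by (simp add: power_mult_distrib add_increasing2)
    have "norm (of_int (fst p) * \<tau> + of_int (snd p)) ^ 4 = ((u * y)\<^sup>2 + v\<^sup>2)\<^sup>2"
      using cmod_power2[of "of_int (fst p) * \<tau> + of_int (snd p)"]
      by (simp add: \<tau>_def uv power4_eq_xxxx power2_eq_square algebra_simps)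
    then have "norm (?f p) = 1 / ((u * y)\<^sup>2 + v\<^sup>2)\<^sup>2"
      by (simp add: norm_divide norm_power)
    also have "\<dots> \<le> 3 / ((1 + (u * y)\<^sup>2) * (1 + v\<^sup>2))"
      using 1 by (rule inverse_square_form_le)
    \<comment> \<open>Because \<open>u^2 \<ge> 1\<close>, a factor \<open>y^2\<close> can be pulled
      out of the term in \<open>u\<close>; this is why the pairs with first entry 0 are set
      apart.\<close>
    also have "\<dots> \<le> 3 / (y\<^sup>2 / 2 * (1 + u\<^sup>2) * (1 + v\<^sup>2))"
    proof (intro divide_left_mono mult_right_mono mult_pos_pos)
      have "y\<^sup>2 * 1 \<le> y\<^sup>2 * u\<^sup>2" using u by (intro mult_left_mono) auto
      then show "y\<^sup>2 / 2 * (1 + u\<^sup>2) \<le> 1 + (u * y)\<^sup>2"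
        by (simp add: power_mult_distrib algebra_simps)
    qed (use y in \<open>auto simp: add_pos_nonneg\<close>)
    also have "\<dots> = 2 / y\<^sup>2 * lattice_majorant p"
      using y by (simp add: lattice_majorant_def uv case_prod_unfold)
    finally show "norm (?f p) \<le> 2 / y\<^sup>2 * lattice_majorant p" .
  qed
  also have "\<dots> < 2"
  proof -
    have "M < y * 1" by (simp add: y_def)
    also have "\<dots> \<le> y * y" using y by (intro mult_left_mono) auto
    finally show ?thesis using y by (simp add: field_simps power2_eq_square)
  qed
  finally have "norm (infsum ?f ?A) < 2" .
  then have "infsum ?f ?A \<noteq> - 2" by auto
  then have "infsum ?f coprime_pairs \<noteq> 0"
    unfolding eq by (simp only: add_eq_0_iff2 not_False_eq_True)
  then have "eisenstein 4 \<tau> \<noteq> 0" by (simp add: eisenstein_alt_def)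
  then show ?thesis using that[of \<tau>] t by (simp add: upper_half_plane_def)
qed

section \<open>Expansions at the cusp in the exponential variable\<close>

definition q_holomorphic :: "(complex \<Rightarrow> complex) \<Rightarrow> bool" where
  "q_holomorphic f \<longleftrightarrow> (\<exists>h. h holomorphic_on ball 0 1 \<and>
     (\<forall>\<tau> \<in> upper_half_plane. f \<tau> = h (exp (2 * of_real pi * \<i> * \<tau>))))"

lemma exp_2pi_i_in_ball: "\<tau> \<in> upper_half_plane \<Longrightarrow> exp (2 * of_real pi * \<i> * \<tau>) \<in> ball 0 1"
  by (simp add: upper_half_plane_def norm_exp_eq_Re)

text \<open>Composed with a logarithm, \<open>f\<close> descends to the punctured unit disc, since
  periodicity absorbs the choice of branch. Boundedness then makes the singularity at 0
  removable.\<close>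

lemma periodic_bounded_imp_q_holomorphic:
  assumes hol: "f holomorphic_on upper_half_plane"
    and per: "\<And>\<tau> n. \<tau> \<in> upper_half_plane \<Longrightarrow> f (\<tau> + of_int n) = f \<tau>"
    and bdd: "\<And>\<tau>. Im \<tau> \<ge> 1 \<Longrightarrow> norm (f \<tau>) \<le> B"
  shows "q_holomorphic f"
proof -
  define c where "c = 2 * of_real pi * \<i>"
  have c: "c \<noteq> 0" by (simp add: c_def)
  define g where "g = (\<lambda>q. f (Ln q / c))"
  have g_exp: "g (exp (c * \<tau>)) = f \<tau>" if t: "\<tau> \<in> upper_half_plane" for \<tau>
  proof -
    have "exp (Ln (exp (c * \<tau>))) = exp (c * \<tau>)" by simp
    then obtain n :: int where "Ln (exp (c * \<tau>)) = c * \<tau> + (of_int (2 * n) * pi) * \<i>"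
      unfolding exp_eq by blast
    then have "Ln (exp (c * \<tau>)) / c = \<tau> + of_int n"
      using c by (simp add: field_simps) (simp add: c_def)
    then show ?thesis using per[OF t] by (simp add: g_def)
  qed
  have Im_div: "Im (w / c) = - Re w / (2 * pi)" for w
    by (simp add: c_def Im_divide power2_eq_square)
  have inH: "Ln q / c \<in> upper_half_plane" "(Ln (- q) + of_real pi * \<i>) / c \<in> upper_half_plane"
    if "q \<in> ball 0 1 - {0}" for q
    using that by (auto simp: upper_half_plane_def Im_div divide_less_0_iff)
  have hol1: "g holomorphic_on (ball 0 1 - {0} - \<real>\<^sub>\<le>\<^sub>0)"
    unfolding g_def
    by (rule holomorphic_on_compose_gen[OF _ hol, unfolded o_def])
      (use inH(1) c in \<open>force intro!: holomorphic_intros\<close>)+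
  \<comment> \<open>The principal \<open>Ln\<close> jumps across the negative real axis. The branch
    \<open>Ln (- q) + of_real pi * \<i>\<close> is holomorphic there and yields the same
    \<open>g\<close>; together the two slit discs cover the punctured disc.\<close>
  have hol2': "(\<lambda>q. f ((Ln (- q) + of_real pi * \<i>) / c)) holomorphic_on (ball 0 1 - {0} - uminus ` \<real>\<^sub>\<le>\<^sub>0)"
    by (rule holomorphic_on_compose_gen[OF _ hol, unfolded o_def])
      (use inH(2) c in \<open>force intro!: holomorphic_intros simp: image_iff\<close>)+
  have hol2: "g holomorphic_on (ball 0 1 - {0} - uminus ` \<real>\<^sub>\<le>\<^sub>0)"
  proof (rule holomorphic_transform[OF hol2'])
    fix q assume q: "q \<in> ball 0 1 - {0} - uminus ` (\<real>\<^sub>\<le>\<^sub>0 :: complex set)"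
    have "exp (c * ((Ln (- q) + of_real pi * \<i>) / c)) = q"
      using c q by (simp add: exp_add)
    then show "f ((Ln (- q) + of_real pi * \<i>) / c) = g q"
      using g_exp[OF inH(2)[of q]] q by simp
  qed
  have op: "open (ball 0 1 - {0} - (\<real>\<^sub>\<le>\<^sub>0 :: complex set))"
    "open (ball 0 1 - {0} - uminus ` (\<real>\<^sub>\<le>\<^sub>0 :: complex set))"
    by (intro open_Diff open_ball closed_negations closed_nonpos_Reals_complex closed_singleton)+
  have "g holomorphic_on ((ball 0 1 - {0} - \<real>\<^sub>\<le>\<^sub>0) \<union> (ball 0 1 - {0} - uminus ` \<real>\<^sub>\<le>\<^sub>0))"
    by (rule holomorphic_on_Un[OF hol1 hol2 op])
  also have "(ball 0 1 - {0} - \<real>\<^sub>\<le>\<^sub>0) \<union> (ball 0 1 - {0} - uminus ` \<real>\<^sub>\<le>\<^sub>0) = ball 0 1 - {0 :: complex}"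
    by (auto simp: complex_nonpos_Reals_iff complex_eq_iff)
  finally have holg: "g holomorphic_on ball 0 1 - {0}" .
  have "\<forall>\<^sub>F q in at 0. norm (g q) \<le> B"
    unfolding eventually_at
  \<comment> \<open>This radius is the norm of the exponential variable at height 1, where the bound
    on \<open>f\<close> begins.\<close>
  proof (intro exI[of _ "exp (- 2 * pi)"] conjI ballI impI)
    fix q :: complex assume q: "q \<noteq> 0 \<and> dist q 0 < exp (- 2 * pi)"
    then have "ln (norm q) < - 2 * pi" by (metis dist_0_norm dist_commute exp_gt_zero ln_exp ln_less_cancel_iff zero_less_norm_iff)
    then have "Im (Ln q / c) \<ge> 1" using q by (simp add: Im_div field_simps)
    then show "norm (g q) \<le> B" unfolding g_def by (rule bdd)
  qed simp
  then obtain h where h: "h holomorphic_on ball 0 1" "\<And>z. z \<in> ball 0 1 - {0} \<Longrightarrow> h z = g z"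
    using holomorphic_on_extend_bounded[OF holg] by auto
  have "f \<tau> = h (exp (c * \<tau>))" if "\<tau> \<in> upper_half_plane" for \<tau>
    using h(2)[of "exp (c * \<tau>)"] exp_2pi_i_in_ball[OF that] g_exp[OF that] by (simp add: c_def)
  then show ?thesis unfolding q_holomorphic_def using h(1) by (auto simp: c_def)
qed

lemma eisenstein_q_holomorphic:
  assumes "k \<ge> 4"
  shows "q_holomorphic (eisenstein k)"
proof -
  obtain B where "\<And>\<tau>. Im \<tau> \<ge> 1 \<Longrightarrow> norm (eisenstein k \<tau>) \<le> B"
    using eisenstein_bounded_at_cusp[OF assms] by blast
  then show ?thesis
    using periodic_bounded_imp_q_holomorphic eisenstein_holomorphic[OF assms] eisenstein_plus_of_int by blast
qed

section \<open>The bracket with the Eisenstein series of weight 4\<close>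

lemma index_mult_mat_vec_sum:
  assumes "A \<in> carrier_mat n m" "v \<in> carrier_vec m" "i < n"
  shows "(A *\<^sub>v v) $ i = (\<Sum>j<m. A $$ (i, j) * v $ j)"
  using assms by (auto simp: scalar_prod_def lessThan_atLeast0 intro!: sum.cong)

lemma index_mult_mat_sum:
  assumes "A \<in> carrier_mat n m" "B \<in> carrier_mat m l" "i < n" "j < l"
  shows "(A * B) $$ (i, j) = (\<Sum>k<m. A $$ (i, k) * B $$ (k, j))"
  using assms by (auto simp: scalar_prod_def lessThan_atLeast0 intro!: sum.cong)

lemma pow_mat_Suc_left:
  assumes A: "A \<in> carrier_mat d d"
  shows "A ^\<^sub>m Suc n = A * A ^\<^sub>m n"
proof (induction n)
  case (Suc n)
  have "A ^\<^sub>m Suc (Suc n) = A * A ^\<^sub>m n * A" using Suc by simp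
  also have "\<dots> = A * (A ^\<^sub>m n * A)" using A by (intro assoc_mult_mat) auto
  finally show ?case by simp
qed (use A in auto)

lemma smult_pow_mat:
  fixes A :: "'a :: comm_semiring_1 mat"
  assumes A: "A \<in> carrier_mat d d"
  shows "(s \<cdot>\<^sub>m A) ^\<^sub>m n = s ^ n \<cdot>\<^sub>m A ^\<^sub>m n"
proof (induction n)
  case (Suc n)
  have "(s \<cdot>\<^sub>m A) ^\<^sub>m Suc n = (s ^ n \<cdot>\<^sub>m A ^\<^sub>m n) * (s \<cdot>\<^sub>m A)" using Suc by simp
  also have "\<dots> = s ^ n \<cdot>\<^sub>m (A ^\<^sub>m n * (s \<cdot>\<^sub>m A))" using A by (intro mult_smult_assoc_mat) auto
  also have "A ^\<^sub>m n * (s \<cdot>\<^sub>m A) = s \<cdot>\<^sub>m (A ^\<^sub>m n * A)"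
    using A by (intro mult_smult_distrib) auto
  finally show ?case by (auto simp: ac_simps intro!: eq_matI)
qed (use A in \<open>auto intro!: eq_matI\<close>)

text \<open>Each further product sums \<open>d\<close> terms, which costs a factor \<open>d\<close>
  besides the entry bound \<open>B\<close>. The exponential series of a matrix is thus dominated by
  a scalar one.\<close>

lemma norm_pow_mat_entry_le:
  fixes A :: "complex mat"
  assumes A: "A \<in> carrier_mat d d" and B: "\<And>i j. i < d \<Longrightarrow> j < d \<Longrightarrow> norm (A $$ (i, j)) \<le> B"
    and ij: "i < d" "j < d"
  shows "norm ((A ^\<^sub>m n) $$ (i, j)) \<le> (of_nat d * B) ^ n"
  using ij
proof (induction n arbitrary: j)
  case (Suc n)
  have B0: "B \<ge> 0" using B[OF ij] norm_ge_zero order_trans by blast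
  have "(A ^\<^sub>m Suc n) $$ (i, j) = (\<Sum>k<d. (A ^\<^sub>m n) $$ (i, k) * A $$ (k, j))"
    unfolding pow_mat.simps by (rule index_mult_mat_sum) (use A Suc.prems in auto)
  also have "norm \<dots> \<le> (\<Sum>k<d. (of_nat d * B) ^ n * B)"
    using Suc.IH Suc.prems B B0 by (intro sum_norm_le) (auto simp: norm_mult intro!: mult_mono)
  finally show ?case by (simp add: algebra_simps)
qed (use A in auto)

lemma mat_exp_entry_series:
  assumes A: "A \<in> carrier_mat d d" and ij: "i < d" "j < d"
  shows "mat_exp (s \<cdot>\<^sub>m A) $$ (i, j) = (\<Sum>n. (A ^\<^sub>m n) $$ (i, j) / fact n * s ^ n)"
    and "summable (\<lambda>n. (A ^\<^sub>m n) $$ (i, j) / fact n * s ^ n)"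
proof -
  show "mat_exp (s \<cdot>\<^sub>m A) $$ (i, j) = (\<Sum>n. (A ^\<^sub>m n) $$ (i, j) / fact n * s ^ n)"
    using A ij by (simp add: mat_exp_def smult_pow_mat[OF A] mult.commute)
  define B where "B = (\<Sum>i<d. \<Sum>j<d. norm (A $$ (i, j)))"
  have B: "norm (A $$ (i, j)) \<le> B" if "i < d" "j < d" for i j
  proof -
    have "norm (A $$ (i, j)) \<le> (\<Sum>j<d. norm (A $$ (i, j)))"
      using that by (intro member_le_sum) auto
    also have "\<dots> \<le> B" unfolding B_def
      using that by (intro member_le_sum[of i "{..<d}" "\<lambda>i. \<Sum>j<d. norm (A $$ (i, j))"] sum_nonneg) auto
    finally show ?thesis .
  qed
  show "summable (\<lambda>n. (A ^\<^sub>m n) $$ (i, j) / fact n * s ^ n)"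
  proof (rule summable_comparison_test')
    show "summable (\<lambda>n. (of_nat d * B * norm s) ^ n /\<^sub>R fact n)" by (rule summable_exp_generic)
    show "norm ((A ^\<^sub>m n) $$ (i, j) / fact n * s ^ n) \<le> (of_nat d * B * norm s) ^ n /\<^sub>R fact n" for n
      using norm_pow_mat_entry_le[OF A B ij, of n]
      by (simp add: norm_mult norm_divide norm_power power_mult_distrib divide_simps mult_right_mono)
  qed
qed

text \<open>Termwise differentiation of the power series. The factor \<open>A\<close> is put on the
  left so that, applied to a form, the derivative becomes the exponent matrix times a vector already
  known to be holomorphic at the cusp.\<close>

lemma mat_exp_entry_has_derivative:
  assumes A: "A \<in> carrier_mat d d" and ij: "i < d" "j < d"
  shows "((\<lambda>s. mat_exp (s \<cdot>\<^sub>m A) $$ (i, j)) has_field_derivative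
           (\<Sum>l<d. A $$ (i, l) * mat_exp (s \<cdot>\<^sub>m A) $$ (l, j))) (at s)"
proof -
  define c where "c = (\<lambda>n. (A ^\<^sub>m n) $$ (i, j) / fact n)"
  have "((\<lambda>s. \<Sum>n. c n * s ^ n) has_field_derivative (\<Sum>n. diffs c n * s ^ n)) (at s)"
    unfolding c_def by (rule termdiffs_strong_converges_everywhere) (rule mat_exp_entry_series[OF A ij])
  moreover have "diffs c n = (\<Sum>l<d. A $$ (i, l) * ((A ^\<^sub>m n) $$ (l, j) / fact n))" for n
  proof -
    have "diffs c n = (A ^\<^sub>m Suc n) $$ (i, j) / fact n"
      unfolding diffs_def c_def by (simp add: field_simps del: pow_mat.simps of_nat_Suc)
    also have "(A ^\<^sub>m Suc n) $$ (i, j) = (\<Sum>l<d. A $$ (i, l) * (A ^\<^sub>m n) $$ (l, j))"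
      unfolding pow_mat_Suc_left[OF A] by (rule index_mult_mat_sum) (use A ij in auto)
    finally show ?thesis by (simp add: sum_divide_distrib)
  qed
  moreover have "(\<Sum>n. (\<Sum>l<d. A $$ (i, l) * ((A ^\<^sub>m n) $$ (l, j) / fact n)) * s ^ n) =
      (\<Sum>l<d. A $$ (i, l) * (\<Sum>n. (A ^\<^sub>m n) $$ (l, j) / fact n * s ^ n))"
  proof -
    have s: "summable (\<lambda>n. (A ^\<^sub>m n) $$ (l, j) / fact n * s ^ n)" if "l < d" for l
      using mat_exp_entry_series(2)[OF A that ij(2)] .
    have "(\<Sum>l<d. A $$ (i, l) * (\<Sum>n. (A ^\<^sub>m n) $$ (l, j) / fact n * s ^ n)) =
        (\<Sum>l<d. \<Sum>n. A $$ (i, l) * ((A ^\<^sub>m n) $$ (l, j) / fact n * s ^ n))"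
      using s by (intro sum.cong refl suminf_mult[symmetric]) auto
    also have "\<dots> = (\<Sum>n. \<Sum>l<d. A $$ (i, l) * ((A ^\<^sub>m n) $$ (l, j) / fact n * s ^ n))"
      using s by (intro suminf_sum[symmetric] summable_mult) auto
    finally show ?thesis by (simp add: sum_distrib_right mult.assoc)
  qed
  ultimately show ?thesis
    using ij by (simp add: c_def mat_exp_entry_series(1)[OF A])
qed

section \<open>Differentiating the transformation law\<close>

lemma SL2Z_rep_unit:
  assumes "SL2Z_rep d \<rho>" "\<gamma> \<in> carrier SL2Z"
  shows "\<rho> \<gamma> \<in> carrier_mat d d"
    and "\<exists>R \<in> carrier_mat d d. R * \<rho> \<gamma> = 1\<^sub>m d"
proof -
  have "\<rho> \<gamma> \<in> carrier (GLC d)" using assms by (auto simp: SL2Z_rep_def hom_def)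
  then have "\<rho> \<gamma> \<in> Units (ring_mat TYPE(complex) d ())" by (simp add: GLC_def units_of_def)
  then show "\<rho> \<gamma> \<in> carrier_mat d d" "\<exists>R \<in> carrier_mat d d. R * \<rho> \<gamma> = 1\<^sub>m d"
    by (auto simp: Units_def ring_mat_def)
qed

lemma modular_formsD:
  assumes "F \<in> modular_forms d \<rho> k"
  shows "\<tau> \<in> upper_half_plane \<Longrightarrow> F \<tau> \<in> carrier_vec d"
    and "i < d \<Longrightarrow> (\<lambda>\<tau>. F \<tau> $ i) holomorphic_on upper_half_plane"
    and "\<gamma> \<in> carrier SL2Z \<Longrightarrow> \<tau> \<in> upper_half_plane \<Longrightarrow>
        F (moebius_act \<gamma> \<tau>) = (moebius_denom \<gamma> \<tau> powi k) \<cdot>\<^sub>v (\<rho> \<gamma> *\<^sub>v F \<tau>)"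
    and "\<exists>L. is_exponent_matrix d \<rho> L \<and> holomorphic_at_cusp d L F"
  using assms by (auto simp: modular_forms_def)

lemma modular_forms_moebius_entry:
  assumes F: "F \<in> modular_forms d \<rho> k" and rep: "SL2Z_rep d \<rho>"
    and g: "\<gamma> \<in> carrier SL2Z" and t: "\<tau> \<in> upper_half_plane" and i: "i < d"
  shows "F (moebius_act \<gamma> \<tau>) $ i = moebius_denom \<gamma> \<tau> powi k * (\<Sum>l<d. \<rho> \<gamma> $$ (i, l) * F \<tau> $ l)"
proof -
  have "F (moebius_act \<gamma> \<tau>) $ i = moebius_denom \<gamma> \<tau> powi k * (\<rho> \<gamma> *\<^sub>v F \<tau>) $ i"
    unfolding modular_formsD(3)[OF F g t] using SL2Z_rep_unit(1)[OF rep g] i by simp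
  then show ?thesis
    using index_mult_mat_vec_sum[OF SL2Z_rep_unit(1)[OF rep g] modular_formsD(1)[OF F t] i] by simp
qed

lemma moebius_act_has_derivative:
  assumes g: "\<gamma> \<in> carrier SL2Z" and t: "\<tau> \<in> upper_half_plane"
  shows "(moebius_act \<gamma> has_field_derivative 1 / moebius_denom \<gamma> \<tau> ^ 2) (at \<tau>)"
proof -
  have nz: "moebius_denom \<gamma> \<tau> \<noteq> 0" by (rule moebius_denom_nonzero[OF g t])
  have "of_int (\<gamma> $$ (0, 0)) * of_int (\<gamma> $$ (1, 1)) - of_int (\<gamma> $$ (0, 1)) * of_int (\<gamma> $$ (1, 0)) = (1 :: complex)"
    using arg_cong[OF SL2Z_det[OF g], of of_int] by simp
  then have "of_int (\<gamma> $$ (0, 0)) * moebius_denom \<gamma> \<tau> -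
      (of_int (\<gamma> $$ (0, 0)) * \<tau> + of_int (\<gamma> $$ (0, 1))) * of_int (\<gamma> $$ (1, 0)) = 1"
    unfolding moebius_denom_def by (simp add: algebra_simps)
  then show ?thesis
    using nz unfolding moebius_act_def[abs_def] moebius_denom_def
    by (auto intro!: derivative_eq_intros simp: power2_eq_square)
qed

text \<open>The chain rule on one side is compared with the product rule on the other; the
  derivative of the action is an inverse square of the automorphy factor, which accounts for the
  added weight 2. The function \<open>h\<close> is kept apart from \<open>f\<close> because for a
  vector-valued form it is an entry of \<open>\<rho> \<gamma>\<close> times the form.\<close>

lemma deriv_moebius:
  assumes f: "f holomorphic_on upper_half_plane" and h: "h holomorphic_on upper_half_plane"
    and fh: "\<And>\<tau>. \<tau> \<in> upper_half_plane \<Longrightarrow> f (moebius_act \<gamma> \<tau>) = moebius_denom \<gamma> \<tau> powi k * h \<tau>"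
    and g: "\<gamma> \<in> carrier SL2Z" and t: "\<tau> \<in> upper_half_plane"
  shows "deriv f (moebius_act \<gamma> \<tau>) = moebius_denom \<gamma> \<tau> powi (k + 2) * deriv h \<tau> +
           of_int k * of_int (\<gamma> $$ (1, 0)) * moebius_denom \<gamma> \<tau> powi (k + 1) * h \<tau>"
proof -
  define w where "w = moebius_denom \<gamma> \<tau>"
  have w: "w \<noteq> 0" unfolding w_def by (rule moebius_denom_nonzero[OF g t])
  note act = moebius_act_in_upper_half_plane[OF g t]
  have "((\<lambda>\<sigma>. f (moebius_act \<gamma> \<sigma>)) has_field_derivative deriv f (moebius_act \<gamma> \<tau>) * (1 / w ^ 2)) (at \<tau>)"
    unfolding w_def
    by (rule DERIV_chain2[OF holomorphic_derivI[OF f open_upper_half_plane act]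
          moebius_act_has_derivative[OF g t]])
  moreover have "((\<lambda>\<sigma>. f (moebius_act \<gamma> \<sigma>)) has_field_derivative
      (of_int k * w powi (k - 1) * of_int (\<gamma> $$ (1, 0)) * h \<tau> + w powi k * deriv h \<tau>)) (at \<tau>)"
  proof (rule has_field_derivative_transform_within_open[OF _ open_upper_half_plane t])
    have "(moebius_denom \<gamma> has_field_derivative of_int (\<gamma> $$ (1, 0))) (at \<tau>)"
      unfolding moebius_denom_def[abs_def] by (auto intro!: derivative_eq_intros)
    from DERIV_mult[OF DERIV_power_int[OF this] holomorphic_derivI[OF h open_upper_half_plane t], of k] w
    show "((\<lambda>\<sigma>. moebius_denom \<gamma> \<sigma> powi k * h \<sigma>) has_field_derivative
      (of_int k * w powi (k - 1) * of_int (\<gamma> $$ (1, 0)) * h \<tau> + w powi k * deriv h \<tau>)) (at \<tau>)"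
      by (simp add: w_def algebra_simps)
  qed (simp add: fh)
  ultimately have "deriv f (moebius_act \<gamma> \<tau>) * (1 / w ^ 2) =
      of_int k * w powi (k - 1) * of_int (\<gamma> $$ (1, 0)) * h \<tau> + w powi k * deriv h \<tau>"
    by (rule DERIV_unique)
  moreover have "w powi (k + 2) = w powi (k - 1) * w ^ 3" "w powi (k + 1) = w powi (k - 1) * w ^ 2"
    "w powi k = w powi (k - 1) * w"
    using w power_int_add[of w "k - 1" 3] power_int_add[of w "k - 1" 2] power_int_add[of w "k - 1" 1]
    by (simp_all add: add.commute)
  ultimately show ?thesis
    using w unfolding w_def[symmetric] by (simp add: field_simps power2_eq_square power3_eq_cube)
qed

text \<open>The first Rankin--Cohen bracket of \<open>E\<^sub>4\<close> and a form of weight \<open>k\<close>: the terms that spoil the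
  transformation laws of the two derivatives cancel. It takes the place of the Serre derivative,
  which would give the sharper bound 2 on the gaps between weights but needs \<open>E\<^sub>2\<close>.\<close>

definition E4_bracket :: "nat \<Rightarrow> int \<Rightarrow> (complex \<Rightarrow> complex vec) \<Rightarrow> complex \<Rightarrow> complex vec" where
  "E4_bracket d k F \<tau> = Matrix.vec d (\<lambda>i. 4 * eisenstein 4 \<tau> * deriv (\<lambda>\<sigma>. F \<sigma> $ i) \<tau>
     - of_int k * deriv (eisenstein 4) \<tau> * F \<tau> $ i)"

lemma E4_bracket_moebius:
  assumes F: "F \<in> modular_forms d \<rho> k" and rep: "SL2Z_rep d \<rho>"
    and g: "\<gamma> \<in> carrier SL2Z" and t: "\<tau> \<in> upper_half_plane"
  shows "E4_bracket d k F (moebius_act \<gamma> \<tau>) =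
    (moebius_denom \<gamma> \<tau> powi (k + 6)) \<cdot>\<^sub>v (\<rho> \<gamma> *\<^sub>v E4_bracket d k F \<tau>)"
proof (rule eq_vecI)
  have R: "\<rho> \<gamma> \<in> carrier_mat d d" by (rule SL2Z_rep_unit(1)[OF rep g])
  show "dim_vec (E4_bracket d k F (moebius_act \<gamma> \<tau>)) =
    dim_vec ((moebius_denom \<gamma> \<tau> powi (k + 6)) \<cdot>\<^sub>v (\<rho> \<gamma> *\<^sub>v E4_bracket d k F \<tau>))"
    using R by (simp add: E4_bracket_def)
  fix i assume "i < dim_vec ((moebius_denom \<gamma> \<tau> powi (k + 6)) \<cdot>\<^sub>v (\<rho> \<gamma> *\<^sub>v E4_bracket d k F \<tau>))"
  then have i: "i < d" using R by simp
  define w c where "w = moebius_denom \<gamma> \<tau>" and "c = (of_int (\<gamma> $$ (1, 0)) :: complex)"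
  have w: "w \<noteq> 0" unfolding w_def by (rule moebius_denom_nonzero[OF g t])
  define h where "h = (\<lambda>\<tau>. \<Sum>l<d. \<rho> \<gamma> $$ (i, l) * F \<tau> $ l)"
  have hol: "(\<lambda>\<tau>. F \<tau> $ l) holomorphic_on upper_half_plane" if "l < d" for l
    by (rule modular_formsD(2)[OF F that])
  have h: "h holomorphic_on upper_half_plane"
    unfolding h_def by (intro holomorphic_intros hol) auto
  have dh: "deriv h \<tau> = (\<Sum>l<d. \<rho> \<gamma> $$ (i, l) * deriv (\<lambda>\<sigma>. F \<sigma> $ l) \<tau>)"
    unfolding h_def
    by (rule DERIV_imp_deriv, intro DERIV_sum DERIV_cmult)
      (use hol in \<open>auto intro: holomorphic_derivI[OF _ open_upper_half_plane t]\<close>)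
  have Fi: "F (moebius_act \<gamma> \<sigma>) $ i = moebius_denom \<gamma> \<sigma> powi k * h \<sigma>" if "\<sigma> \<in> upper_half_plane" for \<sigma>
    unfolding h_def by (rule modular_forms_moebius_entry[OF F rep g that i])
  have E: "eisenstein 4 holomorphic_on upper_half_plane" by (rule eisenstein_holomorphic) simp
  have Em: "eisenstein 4 (moebius_act \<gamma> \<sigma>) = moebius_denom \<gamma> \<sigma> powi 4 * eisenstein 4 \<sigma>"
    if "\<sigma> \<in> upper_half_plane" for \<sigma>
    using eisenstein_moebius[OF g that, of 4] by simp
  have dF: "deriv (\<lambda>\<sigma>. F \<sigma> $ i) (moebius_act \<gamma> \<tau>) =
      w powi (k + 2) * deriv h \<tau> + of_int k * c * w powi (k + 1) * h \<tau>"
    unfolding w_def c_def by (rule deriv_moebius[OF hol[OF i] h Fi g t])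
  have dE: "deriv (eisenstein 4) (moebius_act \<gamma> \<tau>) =
      w powi (4 + 2) * deriv (eisenstein 4) \<tau> + of_int 4 * c * w powi (4 + 1) * eisenstein 4 \<tau>"
    unfolding w_def c_def by (rule deriv_moebius[OF E E Em g t])
  have pw: "w powi (k + of_nat n) = w powi k * w ^ n" for n
    using w by (simp add: power_int_add)
  have "E4_bracket d k F (moebius_act \<gamma> \<tau>) $ i =
      4 * (w powi 4 * eisenstein 4 \<tau>) * (w powi (k + 2) * deriv h \<tau> + of_int k * c * w powi (k + 1) * h \<tau>)
      - of_int k * (w powi (4 + 2) * deriv (eisenstein 4) \<tau> + of_int 4 * c * w powi (4 + 1) * eisenstein 4 \<tau>)
        * (w powi k * h \<tau>)"
    using i unfolding E4_bracket_def by (simp add: dF dE Em[OF t] Fi[OF t] w_def)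
  \<comment> \<open>The two terms containing \<open>c\<close> both equal \<open>4 * of_int k * c * w
    powi (k + 5) * eisenstein 4 \<tau> * h \<tau>\<close> and cancel.\<close>
  also have "\<dots> = w powi (k + 6) * (4 * eisenstein 4 \<tau> * deriv h \<tau> - of_int k * deriv (eisenstein 4) \<tau> * h \<tau>)"
    using pw[of 1] pw[of 2] pw[of 6] by (simp add: algebra_simps flip: power_add) (simp add: eval_nat_numeral algebra_simps)
  also have "4 * eisenstein 4 \<tau> * deriv h \<tau> - of_int k * deriv (eisenstein 4) \<tau> * h \<tau> =
      (\<Sum>l<d. \<rho> \<gamma> $$ (i, l) * E4_bracket d k F \<tau> $ l)"
    unfolding dh unfolding h_def E4_bracket_def
    by (simp add: sum_distrib_left algebra_simps flip: sum_subtractf)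
  also have "\<dots> = (\<rho> \<gamma> *\<^sub>v E4_bracket d k F \<tau>) $ i"
    using index_mult_mat_vec_sum[OF R _ i, of "E4_bracket d k F \<tau>"] by (simp add: E4_bracket_def)
  finally show "E4_bracket d k F (moebius_act \<gamma> \<tau>) $ i =
      ((moebius_denom \<gamma> \<tau> powi (k + 6)) \<cdot>\<^sub>v (\<rho> \<gamma> *\<^sub>v E4_bracket d k F \<tau>)) $ i"
    using R i by (simp add: w_def)
qed

section \<open>The bracket at the cusp\<close>

lemma q_expansion_has_derivative:
  assumes h: "h holomorphic_on ball 0 1" and t: "\<tau> \<in> upper_half_plane"
  defines "q \<equiv> \<lambda>\<tau>. exp (2 * of_real pi * \<i> * \<tau>)"
  shows "((\<lambda>\<tau>. h (q \<tau>)) has_field_derivative 2 * of_real pi * \<i> * q \<tau> * deriv h (q \<tau>)) (at \<tau>)"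
proof -
  have "(q has_field_derivative q \<tau> * (2 * of_real pi * \<i>)) (at \<tau>)"
    unfolding q_def by (auto intro!: derivative_eq_intros)
  from DERIV_chain2[OF holomorphic_derivI[OF h open_ball] this] exp_2pi_i_in_ball[OF t]
  show ?thesis by (simp add: q_def mult_ac)
qed

text \<open>Let \<open>M\<close> be the exponential that twists the form. Scalars commute with
  \<open>M\<close>, so only \<open>M\<close> times the derivative of \<open>F\<close> is at issue.
  By the product rule it is the derivative of \<open>M F\<close> plus
  \<open>2 \<pi> \<i> L M F\<close>. Both are holomorphic in \<open>q\<close>, since differentiation
  in \<open>\<tau>\<close> acts on functions of \<open>q\<close> as \<open>2 \<pi> \<i> q\<close>
  times differentiation in \<open>q\<close>.\<close>

lemma E4_bracket_holomorphic_at_cusp: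
  assumes F: "F \<in> modular_forms d \<rho> k" and L: "L \<in> carrier_mat d d" and cusp: "holomorphic_at_cusp d L F"
  shows "holomorphic_at_cusp d L (E4_bracket d k F)"
proof -
  define c where "c = 2 * of_real pi * \<i>"
  define q where "q = (\<lambda>\<tau>. exp (2 * of_real pi * \<i> * \<tau>))"
  define M where "M = (\<lambda>\<tau>. mat_exp ((- 2 * of_real pi * \<i> * \<tau>) \<cdot>\<^sub>m L))"
  have Mc: "M \<tau> \<in> carrier_mat d d" for \<tau> using L by (simp add: M_def mat_exp_def)
  have Fc: "F \<tau> \<in> carrier_vec d" if "\<tau> \<in> upper_half_plane" for \<tau> by (rule modular_formsD(1)[OF F that])
  have qb: "q \<tau> \<in> ball 0 1" if "\<tau> \<in> upper_half_plane" for \<tau>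
    unfolding q_def by (rule exp_2pi_i_in_ball[OF that])
  obtain h where h: "\<And>i. i < d \<Longrightarrow> h i holomorphic_on ball 0 1"
    and h_eq: "\<And>i \<tau>. i < d \<Longrightarrow> \<tau> \<in> upper_half_plane \<Longrightarrow> (M \<tau> *\<^sub>v F \<tau>) $ i = h i (q \<tau>)"
    using cusp unfolding holomorphic_at_cusp_def M_def q_def by metis
  have MF: "(\<Sum>j<d. M \<tau> $$ (i, j) * F \<tau> $ j) = h i (q \<tau>)" if "i < d" "\<tau> \<in> upper_half_plane" for i \<tau>
    using index_mult_mat_vec_sum[OF Mc Fc[OF that(2)] that(1), of \<tau>] h_eq[OF that] by simp
  obtain e where e: "e holomorphic_on ball 0 1" "\<And>\<tau>. \<tau> \<in> upper_half_plane \<Longrightarrow> eisenstein 4 \<tau> = e (q \<tau>)"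
    using eisenstein_q_holomorphic[of 4] unfolding q_holomorphic_def q_def by auto
  have dE: "deriv (eisenstein 4) \<tau> = c * q \<tau> * deriv e (q \<tau>)" if t: "\<tau> \<in> upper_half_plane" for \<tau>
    by (rule DERIV_imp_deriv, rule has_field_derivative_transform_within_open[OF _ open_upper_half_plane t])
      (use q_expansion_has_derivative[OF e(1) t] e(2) in \<open>auto simp: c_def q_def\<close>)
  have MF': "(\<Sum>j<d. M \<tau> $$ (i, j) * deriv (\<lambda>\<sigma>. F \<sigma> $ j) \<tau>) =
      c * q \<tau> * deriv (h i) (q \<tau>) + c * (\<Sum>l<d. L $$ (i, l) * h l (q \<tau>))"
    if i: "i < d" and t: "\<tau> \<in> upper_half_plane" for i \<tau>
  proof -
    have dM: "((\<lambda>\<tau>. M \<tau> $$ (i, j)) has_field_derivative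
        (\<Sum>l<d. L $$ (i, l) * M \<tau> $$ (l, j)) * (- c)) (at \<tau>)" if "j < d" for j
      unfolding M_def
      by (rule DERIV_chain2[OF mat_exp_entry_has_derivative[OF L i that]])
        (auto intro!: derivative_eq_intros simp: c_def)
    have dF: "((\<lambda>\<tau>. F \<tau> $ j) has_field_derivative deriv (\<lambda>\<sigma>. F \<sigma> $ j) \<tau>) (at \<tau>)" if "j < d" for j
      by (rule holomorphic_derivI[OF modular_formsD(2)[OF F that] open_upper_half_plane t])
    have "((\<lambda>\<tau>. \<Sum>j<d. M \<tau> $$ (i, j) * F \<tau> $ j) has_field_derivative
        (\<Sum>j<d. (\<Sum>l<d. L $$ (i, l) * M \<tau> $$ (l, j)) * (- c) * F \<tau> $ j
               + deriv (\<lambda>\<sigma>. F \<sigma> $ j) \<tau> * M \<tau> $$ (i, j))) (at \<tau>)"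
      by (intro DERIV_sum DERIV_mult dM dF) auto
    moreover have "((\<lambda>\<tau>. \<Sum>j<d. M \<tau> $$ (i, j) * F \<tau> $ j) has_field_derivative
        c * q \<tau> * deriv (h i) (q \<tau>)) (at \<tau>)"
      by (rule has_field_derivative_transform_within_open[OF _ open_upper_half_plane t])
        (use q_expansion_has_derivative[OF h[OF i] t] MF[OF i] in \<open>auto simp: c_def q_def\<close>)
    ultimately have "(\<Sum>j<d. (\<Sum>l<d. L $$ (i, l) * M \<tau> $$ (l, j)) * (- c) * F \<tau> $ j
               + deriv (\<lambda>\<sigma>. F \<sigma> $ j) \<tau> * M \<tau> $$ (i, j)) = c * q \<tau> * deriv (h i) (q \<tau>)"
      by (rule DERIV_unique)
    then have "(\<Sum>j<d. (\<Sum>l<d. L $$ (i, l) * M \<tau> $$ (l, j)) * (- c) * F \<tau> $ j)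
        + (\<Sum>j<d. M \<tau> $$ (i, j) * deriv (\<lambda>\<sigma>. F \<sigma> $ j) \<tau>) = c * q \<tau> * deriv (h i) (q \<tau>)"
      by (simp only: sum.distrib mult.commute[of "deriv _ _"])
    moreover have "(\<Sum>j<d. (\<Sum>l<d. L $$ (i, l) * M \<tau> $$ (l, j)) * (- c) * F \<tau> $ j) =
        - c * (\<Sum>l<d. L $$ (i, l) * h l (q \<tau>))"
    proof -
      have "(\<Sum>j<d. (\<Sum>l<d. L $$ (i, l) * M \<tau> $$ (l, j)) * (- c) * F \<tau> $ j) =
          (\<Sum>j<d. \<Sum>l<d. - c * (L $$ (i, l) * (M \<tau> $$ (l, j) * F \<tau> $ j)))"
        by (simp add: sum_distrib_left sum_distrib_right sum_negf mult_ac)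
      also have "\<dots> = (\<Sum>l<d. \<Sum>j<d. - c * (L $$ (i, l) * (M \<tau> $$ (l, j) * F \<tau> $ j)))"
        by (rule sum.swap)
      also have "\<dots> = - c * (\<Sum>l<d. L $$ (i, l) * (\<Sum>j<d. M \<tau> $$ (l, j) * F \<tau> $ j))"
        by (simp only: sum_distrib_left)
      finally show ?thesis using MF t by simp
    qed
    moreover have "S1 + S2 = X \<Longrightarrow> S1 = - c * Y \<Longrightarrow> S2 = X + c * Y" for S1 S2 X Y :: complex
      by (auto simp: algebra_simps)
    ultimately show ?thesis by blast
  qed
  have Mq: "mat_exp ((- 2 * of_real pi * \<i> * \<tau>) \<cdot>\<^sub>m L) = M \<tau>"
    "exp (2 * of_real pi * \<i> * \<tau>) = q \<tau>" for \<tau>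
    by (simp_all only: M_def q_def)
  show ?thesis
    unfolding holomorphic_at_cusp_def Mq
  proof (intro allI impI)
    fix i assume i: "i < d"
    define H where "H = (\<lambda>z. 4 * e z * (c * z * deriv (h i) z + c * (\<Sum>l<d. L $$ (i, l) * h l z))
      - of_int k * (c * z * deriv e z) * h i z)"
    have "H holomorphic_on ball 0 1"
      unfolding H_def by (intro holomorphic_intros holomorphic_deriv h e i open_ball) auto
    moreover have "(M \<tau> *\<^sub>v E4_bracket d k F \<tau>) $ i = H (q \<tau>)" if t: "\<tau> \<in> upper_half_plane" for \<tau>
    proof -
      have "(M \<tau> *\<^sub>v E4_bracket d k F \<tau>) $ i = (\<Sum>j<d. M \<tau> $$ (i, j) * E4_bracket d k F \<tau> $ j)"
        by (rule index_mult_mat_vec_sum[OF Mc _ i]) (simp add: E4_bracket_def)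
      also have "\<dots> = 4 * eisenstein 4 \<tau> * (\<Sum>j<d. M \<tau> $$ (i, j) * deriv (\<lambda>\<sigma>. F \<sigma> $ j) \<tau>)
          - of_int k * deriv (eisenstein 4) \<tau> * (\<Sum>j<d. M \<tau> $$ (i, j) * F \<tau> $ j)"
        by (simp add: E4_bracket_def sum_distrib_left algebra_simps flip: sum_subtractf)
      finally show ?thesis unfolding H_def MF'[OF i t] MF[OF i t] dE[OF t] e(2)[OF t] .
    qed
    ultimately show "\<exists>h. h holomorphic_on ball 0 1 \<and>
        (\<forall>\<tau>\<in>upper_half_plane. (M \<tau> *\<^sub>v E4_bracket d k F \<tau>) $ i = h (q \<tau>))" by blast
  qed
qed

lemma E4_bracket_modular_form:
  assumes F: "F \<in> modular_forms d \<rho> k" and rep: "SL2Z_rep d \<rho>"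
  shows "E4_bracket d k F \<in> modular_forms d \<rho> (k + 6)"
proof -
  have "(\<lambda>\<tau>. E4_bracket d k F \<tau> $ i) holomorphic_on upper_half_plane" if "i < d" for i
  proof -
    have "eisenstein 4 holomorphic_on upper_half_plane" by (rule eisenstein_holomorphic) simp
    then show ?thesis
      using that modular_formsD(2)[OF F that] open_upper_half_plane
      by (auto simp: E4_bracket_def intro!: holomorphic_intros holomorphic_deriv)
  qed
  moreover obtain L where "is_exponent_matrix d \<rho> L" "holomorphic_at_cusp d L F"
    using modular_formsD(4)[OF F] by blast
  then have "\<exists>L. is_exponent_matrix d \<rho> L \<and> holomorphic_at_cusp d L (E4_bracket d k F)"
    using E4_bracket_holomorphic_at_cusp[OF F] by (auto simp: is_exponent_matrix_def)
  ultimately show ?thesis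
    using E4_bracket_moebius[OF F rep] by (auto simp: modular_forms_def) (simp add: E4_bracket_def)
qed

section \<open>Weights of a homogeneous free basis\<close>

text \<open>After multiplication by a power of \<open>x\<close> both sides are polynomials that
  agree at infinitely many points. Several indices may share an exponent, so the coefficient is a
  sum.\<close>

lemma laurent_coefficient:
  fixes u :: "'i \<Rightarrow> complex" and e :: "'i \<Rightarrow> int"
  assumes I: "finite I" and S: "infinite S" "0 \<notin> S"
    and eq: "\<And>x. x \<in> S \<Longrightarrow> g * x powi k = (\<Sum>i\<in>I. u i * x powi e i)"
  shows "g = (\<Sum>i\<in>I. if e i = k then u i else 0)"
proof -
  define m where "m = \<bar>k\<bar> + (\<Sum>i\<in>I. \<bar>e i\<bar>)"
  have "(\<Sum>i\<in>I. \<bar>e i\<bar>) \<ge> 0" by (intro sum_nonneg) auto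
  then have mk: "k + m \<ge> 0" unfolding m_def by linarith
  have me: "e i + m \<ge> 0" if "i \<in> I" for i
  proof -
    have "\<bar>e i\<bar> \<le> (\<Sum>i\<in>I. \<bar>e i\<bar>)" using that I by (intro member_le_sum) auto
    then show ?thesis unfolding m_def by simp
  qed
  define P where "P = (\<Sum>i\<in>I. Polynomial.monom (u i) (nat (e i + m))) - Polynomial.monom g (nat (k + m))"
  have pw: "x ^ nat (n + m) = x powi n * x powi m" if "x \<noteq> 0" "n + m \<ge> 0" for x :: complex and n
    using that power_int_add[of x n m] by (simp add: power_int_def)
  have "poly P x = 0" if "x \<in> S" for x
  proof -
    have x: "x \<noteq> 0" using that S by auto
    have "poly P x = (\<Sum>i\<in>I. u i * x powi e i * x powi m) - g * x powi k * x powi m"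
      using me mk x by (simp add: P_def poly_sum poly_monom pw mult.assoc)
    also have "\<dots> = 0" unfolding eq[OF that] by (simp add: sum_distrib_right)
    finally show ?thesis .
  qed
  then have "S \<subseteq> {x. poly P x = 0}" by blast
  then have "P = 0" using S(1) poly_roots_finite finite_subset by blast
  then have "0 = coeff P (nat (k + m))" by simp
  also have "\<dots> = (\<Sum>i\<in>I. if e i = k then u i else 0) - g"
    using mk me unfolding P_def by (auto simp: coeff_sum eq_nat_nat_iff intro!: sum.cong)
  finally show ?thesis by simp
qed

text \<open>Undoing \<open>\<rho> \<gamma>\<close> after a transformation scales every term by a
  power of the automorphy factor, with its weight as exponent; infinitely many factors separate the
  weights. The terms of weight \<open>k\<close> supply the new coefficients. Monomials in the
  Eisenstein series have weight at least 0, so a generator of weight above \<open>k\<close> receives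
  the coefficient 0.\<close>

lemma homogeneous_coefficients:
  assumes rep: "SL2Z_rep d \<rho>" and G: "G \<in> modular_forms d \<rho> k"
    and F: "\<And>j. j < d \<Longrightarrow> F j \<in> modular_forms d \<rho> (ks ! j)"
    and a: "\<And>j. j < d \<Longrightarrow> a j \<in> modular_ring"
    and eq: "\<And>\<tau>. \<tau> \<in> upper_half_plane \<Longrightarrow> G \<tau> = module_combination d a F \<tau>"
  obtains b where "\<And>j. j < d \<Longrightarrow> b j \<in> modular_ring"
    "\<And>j \<tau>. j < d \<Longrightarrow> ks ! j > k \<Longrightarrow> b j \<tau> = 0"
    "\<And>\<tau> r. \<tau> \<in> upper_half_plane \<Longrightarrow> r < d \<Longrightarrow> G \<tau> $ r = (\<Sum>j<d. b j \<tau> * F j \<tau> $ r)"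
proof -
  have "\<forall>j. \<exists>Nc. j < d \<longrightarrow> (\<forall>\<tau> \<in> upper_half_plane. a j \<tau> =
      (\<Sum>i\<le>fst Nc. \<Sum>l\<le>fst Nc. snd Nc i l * eisenstein 4 \<tau> ^ i * eisenstein 6 \<tau> ^ (l :: nat)))"
    using a unfolding modular_ring_def by fastforce
  from choice[OF this] obtain Nc where Nc: "\<And>j \<tau>. j < d \<Longrightarrow> \<tau> \<in> upper_half_plane \<Longrightarrow> a j \<tau> =
      (\<Sum>i\<le>fst (Nc j). \<Sum>l\<le>fst (Nc j). snd (Nc j) i l * eisenstein 4 \<tau> ^ i * eisenstein 6 \<tau> ^ (l :: nat))"
    by blast
  define N c where "N = (\<lambda>j. fst (Nc j))" and "c = (\<lambda>j. snd (Nc j))"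
  have ac: "a j \<tau> = (\<Sum>i\<le>N j. \<Sum>l\<le>N j. c j i l * eisenstein 4 \<tau> ^ i * eisenstein 6 \<tau> ^ (l :: nat))"
    if "j < d" "\<tau> \<in> upper_half_plane" for j \<tau>
    unfolding N_def c_def by (rule Nc[OF that])
  define wt where "wt = (\<lambda>j i l. 4 * int i + 6 * int l + ks ! j)"
  define b where "b = (\<lambda>j \<tau>. \<Sum>i\<le>N j. \<Sum>l\<le>N j.
      (if wt j i l = k then c j i l else 0) * eisenstein 4 \<tau> ^ i * eisenstein 6 \<tau> ^ l)"
  show ?thesis
  proof
    fix j assume "j < d"
    show "b j \<in> modular_ring"
      unfolding modular_ring_def b_def
      by (intro CollectI exI[of _ "N j"] exI[of _ "\<lambda>i l. if wt j i l = k then c j i l else 0"]) simp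
  next
    fix j \<tau> assume "j < d" "ks ! j > k"
    then have "wt j i l \<noteq> k" for i l by (simp add: wt_def)
    then show "b j \<tau> = 0" by (simp add: b_def)
  next
    fix \<tau> r assume t: "\<tau> \<in> upper_half_plane" and r: "r < d"
    define I where "I = (SIGMA j:{..<d}. {..N j} \<times> {..N j})"
    define u where "u = (\<lambda>(j, i, l). c j i l * eisenstein 4 \<tau> ^ i * eisenstein 6 \<tau> ^ l * F j \<tau> $ r)"
    have sum_I: "(\<Sum>p\<in>I. f p) = (\<Sum>j<d. \<Sum>i\<le>N j. \<Sum>l\<le>N j. f (j, i, l))" for f :: "_ \<Rightarrow> complex"
    proof -
      have "(\<Sum>p\<in>I. f p) = (\<Sum>j<d. \<Sum>il\<in>{..N j} \<times> {..N j}. f (j, il))"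
        unfolding I_def by (subst sum.Sigma) auto
      then show ?thesis by (simp add: sum.cartesian_product)
    qed
    \<comment> \<open>The automorphy factors at \<open>\<tau>\<close> of the matrices with rows
      \<open>(0, -1)\<close> and \<open>(1, n)\<close>.\<close>
    define S where "S = range (\<lambda>n :: nat. \<tau> + of_nat n)"
    have "inj (\<lambda>n :: nat. \<tau> + of_nat n)" by (auto intro: injI)
    then have "infinite S" unfolding S_def by (rule range_inj_infinite)
    moreover have "0 \<notin> S"
      using t by (auto simp: S_def upper_half_plane_def complex_eq_iff)
    moreover have "G \<tau> $ r * x powi k = (\<Sum>p\<in>I. u p * x powi (case p of (j, i, l) \<Rightarrow> wt j i l))" if x: "x \<in> S" for x
    proof -
      obtain n :: nat where n: "x = \<tau> + of_nat n" using x by (auto simp: S_def)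
      have x0: "x \<noteq> 0" using \<open>0 \<notin> S\<close> x by auto
      define \<gamma> where "\<gamma> = mat_of_rows_list 2 [[0, -1], [1, int n]]"
      have g: "\<gamma> \<in> carrier SL2Z" unfolding \<gamma>_def by (rule SL2Z_of_entries) simp
      have den: "moebius_denom \<gamma> \<tau> = x"
        by (simp add: \<gamma>_def moebius_denom_def mat_of_rows_list_def n)
      note act = moebius_act_in_upper_half_plane[OF g t]
      obtain R where R: "R \<in> carrier_mat d d" "R * \<rho> \<gamma> = 1\<^sub>m d"
        using SL2Z_rep_unit(2)[OF rep g] by blast
      \<comment> \<open>Once the inverse of \<open>\<rho> \<gamma>\<close> is applied,
        \<open>\<gamma>\<close> survives only through the scalar \<open>x\<close>.\<close>
      have undo: "(\<Sum>s<d. R $$ (r, s) * H (moebius_act \<gamma> \<tau>) $ s) = x powi m * H \<tau> $ r"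
        if H: "H \<in> modular_forms d \<rho> m" for H m
      proof -
        have Hc: "H \<tau> \<in> carrier_vec d" by (rule modular_formsD(1)[OF H t])
        have rc: "\<rho> \<gamma> \<in> carrier_mat d d" by (rule SL2Z_rep_unit(1)[OF rep g])
        have "(\<Sum>s<d. R $$ (r, s) * H (moebius_act \<gamma> \<tau>) $ s) = (R *\<^sub>v H (moebius_act \<gamma> \<tau>)) $ r"
          by (rule index_mult_mat_vec_sum[OF R(1) modular_formsD(1)[OF H act] r, symmetric])
        also have "R *\<^sub>v H (moebius_act \<gamma> \<tau>) = x powi m \<cdot>\<^sub>v (R *\<^sub>v (\<rho> \<gamma> *\<^sub>v H \<tau>))"
          unfolding modular_formsD(3)[OF H g t] den
          by (rule mult_mat_vec[OF R(1)]) (use rc Hc in simp)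
        also have "R *\<^sub>v (\<rho> \<gamma> *\<^sub>v H \<tau>) = H \<tau>"
          using assoc_mult_mat_vec[OF R(1) rc Hc] R(2) Hc by simp
        finally show ?thesis using Hc r by simp
      qed
      have "G \<tau> $ r * x powi k = (\<Sum>s<d. R $$ (r, s) * G (moebius_act \<gamma> \<tau>) $ s)"
        using undo[OF G] by simp
      also have "\<dots> = (\<Sum>s<d. \<Sum>j<d. R $$ (r, s) * (a j (moebius_act \<gamma> \<tau>) * F j (moebius_act \<gamma> \<tau>) $ s))"
        unfolding eq[OF act] module_combination_def by (simp add: sum_distrib_left)
      also have "\<dots> = (\<Sum>j<d. \<Sum>s<d. R $$ (r, s) * (a j (moebius_act \<gamma> \<tau>) * F j (moebius_act \<gamma> \<tau>) $ s))"
        by (rule sum.swap)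
      also have "\<dots> = (\<Sum>j<d. a j (moebius_act \<gamma> \<tau>) * (x powi (ks ! j) * F j \<tau> $ r))"
      proof (rule sum.cong[OF refl])
        fix j assume "j \<in> {..<d}"
        then have "(\<Sum>s<d. R $$ (r, s) * F j (moebius_act \<gamma> \<tau>) $ s) = x powi (ks ! j) * F j \<tau> $ r"
          using undo[OF F] by simp
        then show "(\<Sum>s<d. R $$ (r, s) * (a j (moebius_act \<gamma> \<tau>) * F j (moebius_act \<gamma> \<tau>) $ s)) =
            a j (moebius_act \<gamma> \<tau>) * (x powi (ks ! j) * F j \<tau> $ r)"
          by (simp add: sum_distrib_left mult.left_commute flip: \<open>_ = x powi (ks ! j) * F j \<tau> $ r\<close>)
      qed
      also have "\<dots> = (\<Sum>j<d. \<Sum>i\<le>N j. \<Sum>l\<le>N j. u (j, i, l) * x powi wt j i l)"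
      proof (rule sum.cong[OF refl])
        fix j assume "j \<in> {..<d}"
        then have j: "j < d" by simp
        have E: "eisenstein 4 (moebius_act \<gamma> \<tau>) ^ i * eisenstein 6 (moebius_act \<gamma> \<tau>) ^ l * x powi (ks ! j) =
            eisenstein 4 \<tau> ^ i * eisenstein 6 \<tau> ^ l * x powi wt j i l" for i l
        proof -
          have "x powi wt j i l = x ^ (4 * i) * x ^ (6 * l) * x powi (ks ! j)"
            using x0 power_int_add[of x "4 * int i + 6 * int l" "ks ! j"]
              power_int_add[of x "4 * int i" "6 * int l"]
              power_int_of_nat[of x "4 * i"] power_int_of_nat[of x "6 * l"]
            by (simp add: wt_def)
          then show ?thesis
            using eisenstein_moebius[OF g t, of 4] eisenstein_moebius[OF g t, of 6]
            by (simp add: den power_mult_distrib mult_ac flip: power_mult)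
        qed
        show "a j (moebius_act \<gamma> \<tau>) * (x powi (ks ! j) * F j \<tau> $ r) =
            (\<Sum>i\<le>N j. \<Sum>l\<le>N j. u (j, i, l) * x powi wt j i l)"
          unfolding ac[OF j act] sum_distrib_right
        proof (intro sum.cong refl)
          fix i l
          have "c j i l * eisenstein 4 (moebius_act \<gamma> \<tau>) ^ i * eisenstein 6 (moebius_act \<gamma> \<tau>) ^ l *
              (x powi (ks ! j) * F j \<tau> $ r) =
            c j i l * F j \<tau> $ r * (eisenstein 4 (moebius_act \<gamma> \<tau>) ^ i *
              eisenstein 6 (moebius_act \<gamma> \<tau>) ^ l * x powi (ks ! j))"
            by (simp only: mult_ac)
          also have "\<dots> = u (j, i, l) * x powi wt j i l"
            unfolding E u_def by simp
          finally show "c j i l * eisenstein 4 (moebius_act \<gamma> \<tau>) ^ i * eisenstein 6 (moebius_act \<gamma> \<tau>) ^ l *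
              (x powi (ks ! j) * F j \<tau> $ r) = u (j, i, l) * x powi wt j i l" .
        qed
      qed
      also have "\<dots> = (\<Sum>p\<in>I. u p * x powi (case p of (j, i, l) \<Rightarrow> wt j i l))" by (simp add: sum_I)
      finally show ?thesis .
    qed
    ultimately have "G \<tau> $ r = (\<Sum>p\<in>I. if (case p of (j, i, l) \<Rightarrow> wt j i l) = k then u p else 0)"
      by (intro laurent_coefficient[where S = S]) (auto simp: I_def)
    also have "\<dots> = (\<Sum>j<d. b j \<tau> * F j \<tau> $ r)"
      unfolding sum_I b_def sum_distrib_right by (intro sum.cong refl) (simp add: u_def)
    finally show "G \<tau> $ r = (\<Sum>j<d. b j \<tau> * F j \<tau> $ r)" .
  qed
qed

lemma modular_ring_holomorphic:
  assumes "a \<in> modular_ring"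
  shows "a holomorphic_on upper_half_plane"
proof -
  obtain N c where eq: "\<And>\<tau>. \<tau> \<in> upper_half_plane \<Longrightarrow>
      a \<tau> = (\<Sum>i\<le>N. \<Sum>l\<le>N. c i l * eisenstein 4 \<tau> ^ i * eisenstein 6 \<tau> ^ (l :: nat))"
    using assms unfolding modular_ring_def by blast
  have "(\<lambda>\<tau>. \<Sum>i\<le>N. \<Sum>l\<le>N. c i l * eisenstein 4 \<tau> ^ i * eisenstein 6 \<tau> ^ (l :: nat))
      holomorphic_on upper_half_plane"
    by (intro holomorphic_intros eisenstein_holomorphic) auto
  then show ?thesis by (rule holomorphic_transform) (simp add: eq)
qed

lemma const_in_modular_ring: "(\<lambda>_. x) \<in> modular_ring"
  unfolding modular_ring_def by (intro CollectI exI[of _ 0] exI[of _ "\<lambda>_ _. x"]) simp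

section \<open>Uniqueness for linear differential systems\<close>

lemma higher_deriv_sum:
  fixes f :: "'i \<Rightarrow> complex \<Rightarrow> complex"
  assumes "finite I" "\<And>i. i \<in> I \<Longrightarrow> f i holomorphic_on S" "open S" "z \<in> S"
  shows "(deriv ^^ n) (\<lambda>w. \<Sum>i\<in>I. f i w) z = (\<Sum>i\<in>I. (deriv ^^ n) (f i) z)"
  using assms(1,2)
proof (induction I rule: finite_induct)
  case (insert i I)
  have "(deriv ^^ n) (\<lambda>w. f i w + (\<Sum>i\<in>I. f i w)) z = (deriv ^^ n) (f i) z + (deriv ^^ n) (\<lambda>w. \<Sum>i\<in>I. f i w) z"
    using insert.prems by (intro higher_deriv_add[OF _ _ assms(3,4)] holomorphic_intros) auto
  then show ?case using insert by simp
qed simp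

text \<open>By the Leibniz rule each derivative at \<open>z\<close> is a combination of lower
  derivatives of all the \<open>f l\<close>, and these vanish by induction. The system couples the
  components, so the induction treats them together.\<close>

lemma linear_ode_higher_deriv_zero:
  fixes f :: "nat \<Rightarrow> complex \<Rightarrow> complex"
  assumes S: "open S" "z \<in> S"
    and f: "\<And>i. i < m \<Longrightarrow> f i holomorphic_on S"
    and c: "\<And>i l. i < m \<Longrightarrow> l < m \<Longrightarrow> c i l holomorphic_on S"
    and ode: "\<And>i w. i < m \<Longrightarrow> w \<in> S \<Longrightarrow> deriv (f i) w = (\<Sum>l<m. c i l w * f l w)"
    and init: "\<And>i. i < m \<Longrightarrow> f i z = 0"
    and i: "i < m"
  shows "(deriv ^^ n) (f i) z = 0"
  using i
proof (induction n arbitrary: i rule: less_induct)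
  case (less n)
  show ?case
  proof (cases n)
    case 0
    then show ?thesis using init less.prems by simp
  next
    case (Suc p)
    have "(deriv ^^ n) (f i) z = (deriv ^^ p) (deriv (f i)) z"
      unfolding Suc by (simp only: funpow_Suc_right o_apply)
    also have "\<dots> = (deriv ^^ p) (\<lambda>w. \<Sum>l<m. c i l w * f l w) z"
      by (rule higher_deriv_transform_within_open[OF _ _ S])
        (use less.prems in \<open>auto intro!: holomorphic_deriv holomorphic_intros f c S simp: ode\<close>)
    also have "\<dots> = (\<Sum>l<m. (deriv ^^ p) (\<lambda>w. c i l w * f l w) z)"
      by (rule higher_deriv_sum[OF _ _ S]) (use less.prems in \<open>auto intro!: holomorphic_intros f c\<close>)
    also have "\<dots> = (\<Sum>l<m. \<Sum>s = 0..p. of_nat (p choose s) * (deriv ^^ s) (c i l) z * (deriv ^^ (p - s)) (f l) z)"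
      using less.prems by (intro sum.cong refl higher_deriv_mult[OF _ _ S] f c) auto
    also have "\<dots> = 0"
      by (intro sum.neutral ballI) (simp add: less.IH Suc)
    finally show ?thesis .
  qed
qed

text \<open>Padding with zero rows gives a square matrix whose row \<open>m\<close> is zero, so its
  determinant vanishes and its kernel is nontrivial.\<close>

lemma exists_annihilating_vec:
  fixes v :: "nat \<Rightarrow> complex vec"
  assumes "m < d" "\<And>i. i < m \<Longrightarrow> v i \<in> carrier_vec d"
  obtains x where "x \<in> carrier_vec d" "x \<noteq> 0\<^sub>v d" "\<And>i. i < m \<Longrightarrow> x \<bullet> v i = 0"
proof -
  define A where "A = Matrix.mat d d (\<lambda>(i, j). if i < m then v i $ j else 0)"
  have A: "A \<in> carrier_mat d d" by (simp add: A_def)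
  have "det A = 0"
  proof -
    have "det A = (\<Sum>j<d. A $$ (m, j) * cofactor A m j)"
      by (rule laplace_expansion_row[OF A assms(1)])
    also have "\<dots> = 0" using assms(1) by (simp add: A_def)
    finally show ?thesis .
  qed
  then obtain x where x: "x \<in> carrier_vec d" "x \<noteq> 0\<^sub>v d" "A *\<^sub>v x = 0\<^sub>v d"
    unfolding det_0_iff_vec_prod_zero[OF A] by blast
  have "x \<bullet> v i = 0" if "i < m" for i
  proof -
    have "row A i = v i" using that assms(1) assms(2)[OF that] by (intro eq_vecI) (auto simp: A_def)
    then have "(A *\<^sub>v x) $ i = v i \<bullet> x" using A that assms(1) by simp
    then show ?thesis
      using x that assms comm_scalar_prod[OF x(1) assms(2)[OF that]] by simp
  qed
  then show ?thesis using that x by blast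
qed

section \<open>Gaps between consecutive weights\<close>

lemma weight_gap_le:
  assumes irr: "irreducible_rep d \<rho>" and basis: "homogeneous_free_basis d \<rho> ks F" and sorted: "sorted ks"
    and m: "0 < m" "m < d"
  shows "ks ! m \<le> ks ! (m - 1) + 6"
proof (rule ccontr)
  assume "\<not> ?thesis"
  then have gap: "ks ! (m - 1) + 6 < ks ! m" by simp
  have rep: "SL2Z_rep d \<rho>" using irr by (simp add: irreducible_rep_def)
  have len: "length ks = d" using basis by (simp add: homogeneous_free_basis_def)
  have F: "F j \<in> modular_forms d \<rho> (ks ! j)" if "j < d" for j
    using basis that by (auto simp: homogeneous_free_basis_def)
  have Fc: "F j \<tau> \<in> carrier_vec d" if "j < d" "\<tau> \<in> upper_half_plane" for j \<tau>
    by (rule modular_formsD(1)[OF F[OF that(1)] that(2)])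
  have hol4: "eisenstein 4 holomorphic_on upper_half_plane" by (rule eisenstein_holomorphic) simp

  have "\<exists>b. (\<forall>l<m. b l \<in> modular_ring) \<and> (\<forall>\<tau> \<in> upper_half_plane. \<forall>r<d.
      E4_bracket d (ks ! i) (F i) \<tau> $ r = (\<Sum>l<m. b l \<tau> * F l \<tau> $ r))" if i: "i < m" for i
  proof -
    let ?G = "E4_bracket d (ks ! i) (F i)"
    have G: "?G \<in> modular_forms d \<rho> (ks ! i + 6)"
      using i m by (intro E4_bracket_modular_form F rep) auto
    have "?G \<in> all_modular_forms d \<rho>"
      unfolding all_modular_forms_def
    proof (intro CollectI exI[of _ "{ks ! i + 6}"] exI[of _ "\<lambda>_. ?G"] conjI ballI)
      fix \<tau> assume "\<tau> \<in> upper_half_plane"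
      then have "?G \<tau> \<in> carrier_vec d" by (rule modular_formsD(1)[OF G])
      then show "?G \<tau> = Matrix.vec d (\<lambda>r. \<Sum>k\<in>{ks ! i + 6}. ?G \<tau> $ r)" by (intro eq_vecI) auto
    qed (use G in auto)
    then obtain a where a: "\<And>j. j < d \<Longrightarrow> a j \<in> modular_ring"
      "\<And>\<tau>. \<tau> \<in> upper_half_plane \<Longrightarrow> ?G \<tau> = module_combination d a F \<tau>"
      using basis unfolding homogeneous_free_basis_def by metis
    obtain b where b: "\<And>j. j < d \<Longrightarrow> b j \<in> modular_ring"
      "\<And>j \<tau>. j < d \<Longrightarrow> ks ! j > ks ! i + 6 \<Longrightarrow> b j \<tau> = 0"
      "\<And>\<tau> r. \<tau> \<in> upper_half_plane \<Longrightarrow> r < d \<Longrightarrow> ?G \<tau> $ r = (\<Sum>j<d. b j \<tau> * F j \<tau> $ r)"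
      using homogeneous_coefficients[OF rep G F a] by blast
    \<comment> \<open>The chain is
      \<open>ks ! i + 6 \<le> ks ! (m - 1) + 6 < ks ! m \<le> ks ! j\<close>.\<close>
    have b0: "b j \<tau> = 0" if "m \<le> j" "j < d" for j \<tau>
    proof -
      have "ks ! i \<le> ks ! (m - 1)" using sorted i m len by (intro sorted_nth_mono) auto
      moreover have "ks ! m \<le> ks ! j" using sorted that len by (intro sorted_nth_mono) auto
      ultimately show ?thesis using gap that by (intro b(2)) auto
    qed
    have "?G \<tau> $ r = (\<Sum>l<m. b l \<tau> * F l \<tau> $ r)" if "\<tau> \<in> upper_half_plane" "r < d" for \<tau> r
      unfolding b(3)[OF that] using m b0 by (intro sum.mono_neutral_right) auto
    then show ?thesis using b(1) m by (intro exI[of _ b]) auto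
  qed
  then obtain b where b: "\<And>i l. i < m \<Longrightarrow> l < m \<Longrightarrow> b i l \<in> modular_ring"
    and bracket: "\<And>i \<tau> r. i < m \<Longrightarrow> \<tau> \<in> upper_half_plane \<Longrightarrow> r < d \<Longrightarrow>
      E4_bracket d (ks ! i) (F i) \<tau> $ r = (\<Sum>l<m. b i l \<tau> * F l \<tau> $ r)"
    by metis

  obtain \<tau>0 where \<tau>0: "\<tau>0 \<in> upper_half_plane" "eisenstein 4 \<tau>0 \<noteq> 0"
    using eisenstein_4_nonzero by blast
  obtain x where x: "x \<in> carrier_vec d" "x \<noteq> 0\<^sub>v d" "\<And>i. i < m \<Longrightarrow> x \<bullet> F i \<tau>0 = 0"
    using exists_annihilating_vec[of m d "\<lambda>i. F i \<tau>0"] m Fc \<tau>0(1) by (auto intro: less_trans)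
  define f where "f = (\<lambda>i \<tau>. \<Sum>r<d. x $ r * F i \<tau> $ r)"
  have f_eq: "x \<bullet> F i \<tau> = f i \<tau>" if "i < d" "\<tau> \<in> upper_half_plane" for i \<tau>
    using Fc[OF that] by (simp add: scalar_prod_def f_def lessThan_atLeast0)
  have holF: "(\<lambda>\<tau>. F i \<tau> $ r) holomorphic_on upper_half_plane" if "i < d" "r < d" for i r
    by (rule modular_formsD(2)[OF F[OF that(1)] that(2)])
  have holf: "f i holomorphic_on upper_half_plane" if "i < m" for i
    unfolding f_def using that m by (intro holomorphic_intros holF) auto
  define U where "U = upper_half_plane \<inter> eisenstein 4 -` (- {0})"
  have U: "open U" "\<tau>0 \<in> U" "U \<subseteq> upper_half_plane"
    unfolding U_def using \<tau>0 hol4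
    by (auto intro!: continuous_open_preimage holomorphic_on_imp_continuous_on open_upper_half_plane)
  \<comment> \<open>The bracket identity solved for the derivative: the subtracted term moves to the
    diagonal, and \<open>4 * eisenstein 4 \<tau>\<close> is divided out.\<close>
  define c where "c = (\<lambda>i l \<tau>. (b i l \<tau> + (if l = i then of_int (ks ! i) * deriv (eisenstein 4) \<tau> else 0))
      / (4 * eisenstein 4 \<tau>))"
  have holc: "c i l holomorphic_on U" if "i < m" "l < m" for i l
  proof -
    have "b i l holomorphic_on U" "eisenstein 4 holomorphic_on U" "deriv (eisenstein 4) holomorphic_on U"
      using holomorphic_on_subset[OF _ U(3)] modular_ring_holomorphic[OF b[OF that]] hol4
        holomorphic_deriv[OF hol4 open_upper_half_plane] by blast+
    then show ?thesis
      unfolding c_def by (cases "l = i") (auto intro!: holomorphic_intros simp: U_def)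
  qed
  have ode: "deriv (f i) \<tau> = (\<Sum>l<m. c i l \<tau> * f l \<tau>)" if i: "i < m" and t: "\<tau> \<in> U" for i \<tau>
  proof -
    have tH: "\<tau> \<in> upper_half_plane" and e: "eisenstein 4 \<tau> \<noteq> 0" using t by (auto simp: U_def)
    have df: "deriv (f i) \<tau> = (\<Sum>r<d. x $ r * deriv (\<lambda>\<sigma>. F i \<sigma> $ r) \<tau>)"
      unfolding f_def
      by (rule DERIV_imp_deriv, intro DERIV_sum DERIV_cmult)
        (use holF i m in \<open>auto intro!: holomorphic_derivI[OF _ open_upper_half_plane tH]\<close>)
    have "4 * eisenstein 4 \<tau> * deriv (f i) \<tau> =
        (\<Sum>r<d. x $ r * (E4_bracket d (ks ! i) (F i) \<tau> $ r
          + of_int (ks ! i) * deriv (eisenstein 4) \<tau> * F i \<tau> $ r))"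
      unfolding df sum_distrib_left by (auto simp: E4_bracket_def algebra_simps intro!: sum.cong)
    also have "\<dots> = (\<Sum>r<d. \<Sum>l<m. b i l \<tau> * (x $ r * F l \<tau> $ r))
        + of_int (ks ! i) * deriv (eisenstein 4) \<tau> * f i \<tau>"
    proof -
      have "x $ r * (E4_bracket d (ks ! i) (F i) \<tau> $ r + of_int (ks ! i) * deriv (eisenstein 4) \<tau> * F i \<tau> $ r)
          = (\<Sum>l<m. b i l \<tau> * (x $ r * F l \<tau> $ r))
            + of_int (ks ! i) * deriv (eisenstein 4) \<tau> * (x $ r * F i \<tau> $ r)" if "r < d" for r
        unfolding bracket[OF i tH that] distrib_left sum_distrib_left by (simp add: mult.left_commute mult.assoc)
      then show ?thesis unfolding f_def sum_distrib_left by (simp add: sum.distrib)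
    qed
    also have "(\<Sum>r<d. \<Sum>l<m. b i l \<tau> * (x $ r * F l \<tau> $ r)) = (\<Sum>l<m. b i l \<tau> * f l \<tau>)"
      unfolding f_def sum_distrib_left by (rule sum.swap)
    also have "of_int (ks ! i) * deriv (eisenstein 4) \<tau> * f i \<tau> =
        (\<Sum>l<m. (if l = i then of_int (ks ! i) * deriv (eisenstein 4) \<tau> else 0) * f l \<tau>)"
      using i by (simp add: if_distrib[of "\<lambda>y. y * _"] cong: if_cong)
    also have "(\<Sum>l<m. b i l \<tau> * f l \<tau>) + \<dots> = (\<Sum>l<m. 4 * eisenstein 4 \<tau> * (c i l \<tau> * f l \<tau>))"
      unfolding sum.distrib[symmetric] using e by (intro sum.cong refl) (simp add: c_def distrib_right)
    finally show ?thesis using e by (simp flip: sum_distrib_left)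
  qed
  \<comment> \<open>The system lives on \<open>U\<close> only, but it forces all derivatives at
    \<open>\<tau>0\<close> to vanish; holomorphy on the connected half plane does the rest.\<close>
  have f0: "f i \<tau> = 0" if i: "i < m" and t: "\<tau> \<in> upper_half_plane" for i \<tau>
  proof (rule holomorphic_fun_eq_0_on_connected[OF holf[OF i] open_upper_half_plane
        connected_upper_half_plane _ \<tau>0(1) t])
    show "(deriv ^^ n) (f i) \<tau>0 = 0" for n
    proof (rule linear_ode_higher_deriv_zero[OF U(1,2) _ holc ode _ i])
      show "f l holomorphic_on U" if "l < m" for l
        by (rule holomorphic_on_subset[OF holf[OF that] U(3)])
      show "f l \<tau>0 = 0" if "l < m" for l
        using x(3)[OF that] f_eq[of l \<tau>0] that m \<tau>0(1) by simp
    qed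
  qed

  \<comment> \<open>The span of the values, written as a double annihilator. In this form the
    subspace laws are immediate and invariance can be checked on functionals.\<close>
  define W where "W = {w \<in> carrier_vec d. \<forall>\<mu> \<in> carrier_vec d.
      (\<forall>i<m. \<forall>\<tau> \<in> upper_half_plane. \<mu> \<bullet> F i \<tau> = 0) \<longrightarrow> \<mu> \<bullet> w = 0}"
  have sub: "VectorSpace.subspace class_ring W (module_vec TYPE(complex) d)"
  proof (rule subspace.intro[OF vec_vs], rule submodule.intro[OF vec_module])
    show "v \<oplus>\<^bsub>module_vec TYPE(complex) d\<^esub> w \<in> W" if "v \<in> W" "w \<in> W" for v w
      using that by (auto simp: W_def module_vec_simps scalar_prod_add_distrib[of _ d])
    show "c \<odot>\<^bsub>module_vec TYPE(complex) d\<^esub> v \<in> W" if "v \<in> W" for c v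
      using that by (auto simp: W_def module_vec_simps)
  qed (auto simp: W_def module_vec_simps)
  have inv: "\<rho> \<gamma> *\<^sub>v w \<in> W" if g: "\<gamma> \<in> carrier SL2Z" and w: "w \<in> W" for \<gamma> w
  proof -
    have rc: "\<rho> \<gamma> \<in> carrier_mat d d" by (rule SL2Z_rep_unit(1)[OF rep g])
    have wc: "w \<in> carrier_vec d" using w by (simp add: W_def)
    have "\<mu> \<bullet> (\<rho> \<gamma> *\<^sub>v w) = 0" if mu: "\<mu> \<in> carrier_vec d"
      "\<forall>i<m. \<forall>\<tau> \<in> upper_half_plane. \<mu> \<bullet> F i \<tau> = 0" for \<mu>
    proof -
      \<comment> \<open>The functional \<open>\<mu>\<close> pulled back along
        \<open>\<rho> \<gamma>\<close>. It kills the values at \<open>\<tau>\<close> because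
        \<open>\<mu>\<close> kills those at \<open>moebius_act \<gamma> \<tau>\<close>.\<close>
      define \<nu> where "\<nu> = (\<rho> \<gamma>)\<^sup>T *\<^sub>v \<mu>"
      have nu: "\<nu> \<in> carrier_vec d" using rc mu by (simp add: \<nu>_def)
      have tr: "\<nu> \<bullet> v = \<mu> \<bullet> (\<rho> \<gamma> *\<^sub>v v)" if "v \<in> carrier_vec d" for v
        unfolding \<nu>_def by (rule transpose_vec_mult_scalar[OF rc that mu(1)])
      have "\<nu> \<bullet> F i \<tau> = 0" if i: "i < m" and t: "\<tau> \<in> upper_half_plane" for i \<tau>
      proof -
        have id: "i < d" using i m by simp
        have "0 = \<mu> \<bullet> F i (moebius_act \<gamma> \<tau>)"
          using mu(2) i moebius_act_in_upper_half_plane[OF g t] by simp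
        also have "\<dots> = moebius_denom \<gamma> \<tau> powi (ks ! i) * (\<mu> \<bullet> (\<rho> \<gamma> *\<^sub>v F i \<tau>))"
          unfolding modular_formsD(3)[OF F[OF id] g t]
          using rc Fc[OF id t] mu(1) by (intro scalar_prod_smult_distrib[of _ d]) auto
        finally show ?thesis
          using tr[OF Fc[OF id t]] moebius_denom_nonzero[OF g t] by simp
      qed
      then have "\<nu> \<bullet> w = 0" using w nu by (auto simp: W_def)
      then show ?thesis using tr[OF wc] by simp
    qed
    then show ?thesis using rc wc by (auto simp: W_def)
  qed
  have "W = {0\<^sub>v d} \<or> W = carrier_vec d"
    using irr sub inv unfolding irreducible_rep_def by blast
  moreover have "W \<noteq> {0\<^sub>v d}"
  proof
    assume W0: "W = {0\<^sub>v d}"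
    have F0: "F 0 \<tau> = 0\<^sub>v d" if "\<tau> \<in> upper_half_plane" for \<tau>
    proof -
      have "F 0 \<tau> \<in> W" using Fc[of 0 \<tau>] that m by (auto simp: W_def)
      then show ?thesis using W0 by simp
    qed
    \<comment> \<open>If \<open>F 0\<close> vanished, the coefficients \<open>1, 0, ..., 0\<close>
      would be a nontrivial relation, contrary to freeness.\<close>
    define a where "a = (\<lambda>(j :: nat) (_ :: complex). if j = 0 then 1 else 0 :: complex)"
    have "a j \<in> modular_ring" for j unfolding a_def by (rule const_in_modular_ring)
    moreover have "module_combination d a F \<tau> = 0\<^sub>v d" if "\<tau> \<in> upper_half_plane" for \<tau>
      unfolding module_combination_def using F0[OF that]
      by (intro eq_vecI) (auto simp: a_def intro!: sum.neutral)
    moreover have "\<forall>a. (\<forall>j<d. a j \<in> modular_ring) \<and>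
        (\<forall>\<tau> \<in> upper_half_plane. module_combination d a F \<tau> = 0\<^sub>v d) \<longrightarrow>
        (\<forall>j<d. \<forall>\<tau> \<in> upper_half_plane. a j \<tau> = 0)"
      using basis unfolding homogeneous_free_basis_def by blast
    ultimately have "\<forall>j<d. \<forall>\<tau> \<in> upper_half_plane. a j \<tau> = 0" by blast
    then have "a 0 \<tau>0 = 0" using \<tau>0(1) m by simp
    then show False by (simp add: a_def)
  qed
  moreover have "W \<noteq> carrier_vec d"
  proof
    assume W: "W = carrier_vec d"
    \<comment> \<open>As \<open>x\<close> kills all values, it kills \<open>W\<close>; were
      \<open>W\<close> everything, \<open>x\<close> would be zero.\<close>
    have xw: "x \<bullet> w = 0" if "w \<in> carrier_vec d" for w
    proof -
      have "\<forall>i<m. \<forall>\<tau> \<in> upper_half_plane. x \<bullet> F i \<tau> = 0" using f0 f_eq m by auto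
      then show ?thesis using that x(1) W unfolding W_def by blast
    qed
    have "x $ r = 0" if "r < d" for r
      using scalar_prod_right_unit[OF that, of x] xw[of "unit_vec d r"] by (metis unit_vec_carrier)
    then have "x = 0\<^sub>v d" using x(1) by (intro eq_vecI) auto
    then show False using x(2) by simp
  qed
  ultimately show False by blast
qed

section \<open>From gaps between weights to types\<close>

lemma weight_le:
  assumes "irreducible_rep d \<rho>" "homogeneous_free_basis d \<rho> ks F" "sorted ks" "m < d"
  shows "ks ! m \<le> ks ! 0 + 6 * int m"
  using assms(4)
proof (induction m)
  case (Suc m)
  then show ?case using weight_gap_le[OF assms(1-3), of "Suc m"] by simp
qed simp

lemma type_bounded:
  assumes irr: "irreducible_rep d \<rho>" and type: "is_type d \<rho> ts"
  shows "length ts = d" "\<forall>t \<in> set ts. t \<le> 6 * d"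
proof -
  obtain ks F where ks: "sorted ks" "homogeneous_free_basis d \<rho> ks F"
    and ts: "ts = map (\<lambda>k. nat (k - ks ! 0)) ks"
    using type unfolding is_type_def by blast
  have len: "length ks = d" using ks(2) by (simp add: homogeneous_free_basis_def)
  then show "length ts = d" by (simp add: ts)
  show "\<forall>t \<in> set ts. t \<le> 6 * d"
  proof
    fix t assume "t \<in> set ts"
    then obtain m where "m < d" "t = nat (ks ! m - ks ! 0)"
      using len by (auto simp: ts in_set_conv_nth)
    \<comment> \<open>Here \<open>m < d\<close>, so the entry is even at most
      \<open>6 * (d - 1)\<close>; the looser bound stays clear of subtraction on
      \<open>nat\<close>.\<close>
    then show "t \<le> 6 * d" using weight_le[OF irr ks(2,1), of m] by simp
  qed
qed

theorem theorem2p9: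
  shows "\<exists>alg :: recf. \<forall>d \<ge> 1. \<exists>tss :: nat list list.
    computes alg [d] (encode_tuples tss) \<and>
    (\<forall>ts \<in> set tss. length ts = d) \<and>
    (\<forall>\<rho> ts. irreducible_rep d \<rho> \<longrightarrow> is_type d \<rho> ts \<longrightarrow> ts \<in> set tss)"
proof -
  obtain alg where alg: "\<forall>d. \<exists>tss. computes alg [d] (encode_tuples tss) \<and> (\<forall>ts \<in> set tss. length ts = d) \<and>
     (\<forall>ts. length ts = d \<longrightarrow> (\<forall>t \<in> set ts. t \<le> 6 * d) \<longrightarrow> ts \<in> set tss)"
    using exists_algorithm_bounded_tuples[of 6] by (elim exE)
  show ?thesis
  proof (rule exI[of _ alg], intro allI impI)
    fix d :: nat
    obtain tss where tss: "computes alg [d] (encode_tuples tss) \<and> (\<forall>ts \<in> set tss. length ts = d) \<and>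
       (\<forall>ts. length ts = d \<longrightarrow> (\<forall>t \<in> set ts. t \<le> 6 * d) \<longrightarrow> ts \<in> set tss)"
      using alg[THEN spec, of d] by (elim exE)
    have "ts \<in> set tss" if "irreducible_rep d \<rho>" "is_type d \<rho> ts" for \<rho> ts
      using tss type_bounded[OF that] by simp
    then show "\<exists>tss. computes alg [d] (encode_tuples tss) \<and> (\<forall>ts \<in> set tss. length ts = d) \<and>
        (\<forall>\<rho> ts. irreducible_rep d \<rho> \<longrightarrow> is_type d \<rho> ts \<longrightarrow> ts \<in> set tss)"
      using tss by (intro exI[of _ tss]) simp
  qed
qed

end
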